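(* The closure of the set of eigenvalues $\bigcup_{n\ge0}\mathrm{Spec}(\Delta(\Gamma_n))\subset\mathbb{R}$ is equal to the support of the KNS measure $\mu$ of the sequence $\Delta(\Gamma_n)$; in particular this closure is a Cantor set.
   Context: Graphs are finite undirected multigraphs, loops allowed. Each $G_n$ ($n\ge 0$) has two boundary vertices, forming $\partial G_n$. $G_0$: two vertices joined by one edge, both boundary. $G_1$: a path $a-b-c$ with a loop at $b$, $\partial G_1=\{a,c\}$. For $n\ge2$, $G_n$ is obtained from one copy of $G_{n-1}$ and two copies of $G_{n-2}$ by identifying to a single vertex both boundary vertices of $G_{n-1}$ and one boundary vertex of each copy of $G_{n-2}$; the remaining boundary vertex of each copy of $G_{n-2}$ form $\partial G_n$. $\Gamma_0$ is one vertex with two loops; for $n\ge1$, $\Gamma_n$ is obtained from a copy of $G_n$ and a copy of $G_{n-1}$ by identifying all four boundary vertices to a single vertex. $\Gamma_n$ has $2^n$ vertices. Laplacian: $\Delta(\Gamma_n)f(x)=\sum_y c_{xy}(f(x)-f(y))$, with $c_{xy}$ the number of edges joining $x,y$ (loops contribute $0$); $\mathrm{Spec}(\Delta(\Gamma_n))$ is its set of eigenvalues. The spectral counting measure is $\nu_n=2^{-n}\sum_\lambda\delta_\lambda$, the sum over the $2^n$ eigenvalues of $\Delta(\Gamma_n)$ counted with multiplicity. The KNS measure $\mu$ is the weak limit of $\nu_n$ as $n\to\infty$ (which exists). A Cantor set is a non-empty compact, perfect, totally disconnected subset of $\mathbb{R}$. *)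

theory Defs
  imports
    "HOL-Probability.Probability"
    "HOL-Library.Uprod"
    "HOL-Library.Multiset"
    "HOL-Library.Function_Algebras"
begin

section \<open>Finite undirected multigraphs\<close>

text \<open>
  An edge is an unordered pair of end points, a loop at \<open>x\<close> being \<open>Upair x x\<close>;
  parallel edges are counted by the multiset.
\<close>

record 'a multigraph =
  verts :: "'a set"
  edges :: "'a uprod multiset"

text \<open>
  The image of a graph under a map of its vertices: vertices with the same image are
  identified, and no edge is lost (an edge between identified vertices becomes a loop).
\<close>

definition map_graph :: "('a \<Rightarrow> 'b) \<Rightarrow> 'a multigraph \<Rightarrow> 'b multigraph" where
  "map_graph h g = \<lparr>verts = h ` verts g, edges = image_mset (map_uprod h) (edges g)\<rparr>"

definition union_graph :: "'a multigraph \<Rightarrow> 'a multigraph \<Rightarrow> 'a multigraph" where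
  "union_graph g h = \<lparr>verts = verts g \<union> verts h, edges = edges g + edges h\<rparr>"


section \<open>The graphs \<open>G\<^sub>n\<close> and \<open>\<Gamma>\<^sub>n\<close>\<close>

text \<open>
  Vertices are named by addresses. In every \<open>G\<^sub>n\<close> the two boundary vertices are \<open>Bd1\<close>
  and \<open>Bd2\<close>; \<open>Ctr\<close> is the vertex at which copies are glued together (the vertex \<open>b\<close> of
  \<open>G\<^sub>1\<close>); the constructors \<open>Cp1\<close>, \<open>Cp2\<close>, \<open>Cp3\<close> keep the non-boundary vertices of the
  different copies disjoint.
\<close>

datatype addr = Bd1 | Bd2 | Ctr | Cp1 addr | Cp2 addr | Cp3 addr

text \<open>
  \<open>place p q i\<close> inserts a copy with its boundary vertices placed at \<open>p\<close> and \<open>q\<close> and its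
  other vertices tagged by \<open>i\<close>. Taking the union of copies so placed amounts to taking
  their disjoint union and identifying exactly the boundary vertices placed at the same
  address.
\<close>

fun place :: "addr \<Rightarrow> addr \<Rightarrow> (addr \<Rightarrow> addr) \<Rightarrow> addr \<Rightarrow> addr" where
  "place p q i Bd1 = p"
| "place p q i Bd2 = q"
| "place p q i v = i v"

text \<open>
  The construction leaves open which boundary vertex of each copy of \<open>G\<^sub>n\<close> is glued. As every
  \<open>G\<^sub>n\<close> has an automorphism exchanging its boundary vertices, the choice does not matter
  up to isomorphism.
\<close>

fun G :: "nat \<Rightarrow> addr multigraph" where
  "G 0 = \<lparr>verts = {Bd1, Bd2}, edges = {#Upair Bd1 Bd2#}\<rparr>"
| "G (Suc 0) =
    \<lparr>verts = {Bd1, Ctr, Bd2}, edges = {#Upair Bd1 Ctr, Upair Ctr Bd2, Upair Ctr Ctr#}\<rparr>"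
| "G (Suc (Suc n)) =
    union_graph (map_graph (place Ctr Ctr Cp3) (G (Suc n)))
      (union_graph (map_graph (place Bd1 Ctr Cp1) (G n)) (map_graph (place Ctr Bd2 Cp2) (G n)))"

fun \<Gamma> :: "nat \<Rightarrow> addr multigraph" where
  "\<Gamma> 0 = \<lparr>verts = {Ctr}, edges = {#Upair Ctr Ctr, Upair Ctr Ctr#}\<rparr>"
| "\<Gamma> (Suc n) =
    union_graph (map_graph (place Ctr Ctr Cp1) (G (Suc n))) (map_graph (place Ctr Ctr Cp2) (G n))"

text \<open>Sanity check on the construction: \<open>\<Gamma>\<^sub>n\<close> has \<open>2\<^sup>n\<close> vertices.\<close>

lemma finite_verts_G: "finite (verts (G n))"
  by (induction n rule: G.induct) (auto simp: map_graph_def union_graph_def)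

lemma Bd_in_verts_G: "Bd1 \<in> verts (G n)" "Bd2 \<in> verts (G n)"
proof -
  have "Bd1 \<in> verts (G n) \<and> Bd2 \<in> verts (G n)"
  proof (induction n rule: G.induct)
    case (3 n)
    have "Bd1 \<in> place Bd1 Ctr Cp1 ` verts (G n)" "Bd2 \<in> place Ctr Bd2 Cp2 ` verts (G n)"
      using 3 by (metis image_eqI place.simps(1), metis image_eqI place.simps(2))
    then show ?case by (simp add: map_graph_def union_graph_def)
  qed auto
  then show "Bd1 \<in> verts (G n)" "Bd2 \<in> verts (G n)" by auto
qed

lemma place_image_G: "place p q i ` verts (G n) = {p, q} \<union> i ` (verts (G n) - {Bd1, Bd2})"
proof -
  have "place p q i v = i v" if "v \<noteq> Bd1" "v \<noteq> Bd2" for v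
    using that by (cases v) auto
  then have "place p q i ` (verts (G n) - {Bd1, Bd2}) = i ` (verts (G n) - {Bd1, Bd2})"
    by (intro image_cong) auto
  moreover have "place p q i ` verts (G n) =
      place p q i ` {Bd1, Bd2} \<union> place p q i ` (verts (G n) - {Bd1, Bd2})"
    using Bd_in_verts_G[of n] by (subst image_Un[symmetric]) (rule arg_cong, blast)
  ultimately show ?thesis by simp
qed

lemma card_interior_G:
  "card (verts (G (Suc (Suc n))) - {Bd1, Bd2}) =
    1 + card (verts (G (Suc n)) - {Bd1, Bd2}) + 2 * card (verts (G n) - {Bd1, Bd2})"
proof -
  let ?I = "\<lambda>n. verts (G n) - {Bd1, Bd2}"
  have fin: "finite (?I k)" for k using finite_verts_G by simp
  have "?I (Suc (Suc n)) = insert Ctr (Cp3 ` ?I (Suc n) \<union> (Cp1 ` ?I n \<union> Cp2 ` ?I n))"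
    by (auto simp: map_graph_def union_graph_def place_image_G)
  also have "card \<dots> = Suc (card (Cp3 ` ?I (Suc n)) + (card (Cp1 ` ?I n) + card (Cp2 ` ?I n)))"
  proof -
    have "card (A \<union> (B \<union> C)) = card A + (card B + card C)"
      if "finite A" "finite B" "finite C" "A \<inter> B = {}" "A \<inter> C = {}" "B \<inter> C = {}"
      for A B C :: "addr set"
      using that by (simp add: card_Un_disjoint Int_Un_distrib)
    from this[of "Cp3 ` ?I (Suc n)" "Cp1 ` ?I n" "Cp2 ` ?I n"] show ?thesis
      using fin by (subst card_insert_disjoint) (auto simp del: G.simps)
  qed
  also have "\<dots> = Suc (card (?I (Suc n)) + (card (?I n) + card (?I n)))"
    by (simp add: card_image inj_on_def)
  finally show ?thesis by simp
qed

lemma card_verts_\<Gamma>: "card (verts (\<Gamma> n)) = 2 ^ n"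
proof -
  let ?I = "\<lambda>n. verts (G n) - {Bd1, Bd2}"
  have fin: "finite (?I k)" for k using finite_verts_G by simp
  have *: "1 + card (?I (Suc k)) + card (?I k) = 2 ^ Suc k" for k
  proof (induction k)
    case 0
    have "?I 0 = {}" "?I (Suc 0) = {Ctr}" by auto
    then show ?case by (simp only: card.empty) simp
  next
    case (Suc k)
    then show ?case using card_interior_G[of k] by (simp del: G.simps)
  qed
  show ?thesis
  proof (cases n)
    case (Suc k)
    have "verts (\<Gamma> (Suc k)) = insert Ctr (Cp1 ` ?I (Suc k) \<union> Cp2 ` ?I k)"
      by (auto simp: map_graph_def union_graph_def place_image_G)
    also have "card \<dots> = Suc (card (Cp1 ` ?I (Suc k)) + card (Cp2 ` ?I k))"
    proof -
      have "card (A \<union> B) = card A + card B"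
        if "finite A" "finite B" "A \<inter> B = {}" for A B :: "addr set"
        using that by (simp add: card_Un_disjoint)
      from this[of "Cp1 ` ?I (Suc k)" "Cp2 ` ?I k"] show ?thesis
        using fin by (subst card_insert_disjoint) (auto simp del: G.simps)
    qed
    also have "\<dots> = Suc (card (?I (Suc k)) + card (?I k))"
      by (simp add: card_image inj_on_def del: G.simps)
    finally show ?thesis using *[of k] Suc by (simp del: G.simps \<Gamma>.simps)
  qed auto
qed


section \<open>Laplacian, spectrum, spectral counting measure\<close>

definition laplacian :: "'a multigraph \<Rightarrow> ('a \<Rightarrow> real) \<Rightarrow> 'a \<Rightarrow> real" where
  "laplacian g f x = (\<Sum>y\<in>verts g. real (count (edges g) (Upair x y)) * (f x - f y))"

text \<open>
  Functions on the vertex set are represented by their extension by \<open>0\<close>, so that the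
  dimension of the eigenspace is the multiplicity.
\<close>

definition eigenspace :: "'a multigraph \<Rightarrow> real \<Rightarrow> ('a \<Rightarrow> real) set" where
  "eigenspace g t =
    {f. (\<forall>x. x \<notin> verts g \<longrightarrow> f x = 0) \<and> (\<forall>x\<in>verts g. laplacian g f x = t * f x)}"

definition Spec :: "'a multigraph \<Rightarrow> real set" where
  "Spec g = {t. \<exists>f\<in>eigenspace g t. f \<noteq> 0}"

lemma vector_space_fun: "vector_space (\<lambda>(c::real) (f::'a \<Rightarrow> real) x. c * f x)"
  by unfold_locales (auto simp: fun_eq_iff algebra_simps)

text \<open>
  The Laplacian is a symmetric operator, so its eigenvalues are real and the geometric
  multiplicity below is also the algebraic one.
\<close>

definition eigenvalue_multiplicity :: "'a multigraph \<Rightarrow> real \<Rightarrow> nat" where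
  "eigenvalue_multiplicity g t = vector_space.dim (\<lambda>(c::real) f x. c * f x) (eigenspace g t)"

definition spectral_counting_measure :: "nat \<Rightarrow> real measure" where
  "spectral_counting_measure n =
    distr (point_measure (Spec (\<Gamma> n)) (\<lambda>t. ennreal (real (eigenvalue_multiplicity (\<Gamma> n) t) / 2 ^ n)))
      borel (\<lambda>t. t)"

definition is_KNS_measure :: "real measure \<Rightarrow> bool" where
  "is_KNS_measure \<mu> \<longleftrightarrow> real_distribution \<mu> \<and> weak_conv_m spectral_counting_measure \<mu>"


section \<open>Support of a measure, Cantor sets\<close>

definition measure_support :: "'a::topological_space measure \<Rightarrow> 'a set" where
  "measure_support \<mu> = {x. \<forall>U. open U \<and> x \<in> U \<longrightarrow> emeasure \<mu> U > 0}"

definition totally_disconnected :: "'a::topological_space set \<Rightarrow> bool" where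
  "totally_disconnected C \<longleftrightarrow> (\<forall>T. T \<subseteq> C \<and> connected T \<longrightarrow> (\<forall>x\<in>T. \<forall>y\<in>T. x = y))"

definition Cantor_set :: "real set \<Rightarrow> bool" where
  "Cantor_set C \<longleftrightarrow>
    C \<noteq> {} \<and> compact C \<and> (\<forall>x\<in>C. x islimpt C) \<and> totally_disconnected C"

end

(*
  Call t a Dirichlet eigenvalue of G_n if it has an eigenfunction vanishing on the boundary, and let
  K be the closure of all Dirichlet eigenvalues. An eigenvalue of Gamma_n lifts to all Gamma_m with
  m >= n, with eigenfunctions of growing norm; cutting them off at the gluing vertex leaves a bounded
  residual, so the eigenvalue is a limit of Dirichlet eigenvalues. Conversely, an eigenfunction of a
  Dirichlet eigenvalue can be combined from two copies into a localized one without boundary flux,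
  of which Gamma_m contains at least c 2^m independent copies, so the KNS measure has an atom there.
  Hence K is both the closure of the spectra and the support.

  K is perfect: on a chain of 2^j copies of the ground state of t, changing the sign pattern in the
  middle gives a function orthogonal to the eigenspace with bounded residual and norm 2^(j/2).

  K contains no interval: the response of G_n to boundary data satisfies a rational recursion in t.
  At a first zero t of its denominator, the parameters close to t on one side enter a region in
  which the denominators never vanish again, so t is the end point of a gap.
*)

theory Submission
  imports Defs
begin

section \<open>The energy form and gluing\<close>

text \<open>Solutions are handled in weak form, tested against all functions, so that gluing copies
  reduces to one flux balance at the centre vertex. The obstacle is that the response recursion
  breaks down at the Dirichlet eigenvalues themselves. Each eigenvalue \<open>t\<close> is therefore
  tied to the least \<open>k\<close> with \<open>den k t = 0\<close>: up to level \<open>k\<close>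
  boundary value problems are still uniquely solvable, and all eigenfunctions are built from the
  ground state of level \<open>k + 1\<close>. Since the construction goes back two levels, chains of
  ground states grow only at every second level, and Dirichlet solutions at the levels in between
  carry no flux; this parity controls the eigenspace on long chains. For perfectness a small
  residual is not enough, since the eigenvalue found could be \<open>t\<close> again; orthogonality
  to the eigenspace excludes this.\<close>

lift_definition edge_form :: "('a \<Rightarrow> real) \<Rightarrow> ('a \<Rightarrow> real) \<Rightarrow> 'a uprod \<Rightarrow> real"
  is "\<lambda>f k (x, y). (f x - f y) * (k x - k y)"
  by (auto simp: algebra_simps)

lemma edge_form_Upair [simp]: "edge_form f k (Upair x y) = (f x - f y) * (k x - k y)"
  by transfer simp

definition energy :: "'a multigraph \<Rightarrow> ('a \<Rightarrow> real) \<Rightarrow> ('a \<Rightarrow> real) \<Rightarrow> real" where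
  "energy g f k = (\<Sum>e\<in>#edges g. edge_form f k e)"

lemma energy_map_graph: "energy (map_graph h g) f k = energy g (\<lambda>x. f (h x)) (\<lambda>x. k (h x))"
proof -
  have "edge_form f k (map_uprod h e) = edge_form (\<lambda>x. f (h x)) (\<lambda>x. k (h x)) e" for e
    by (cases e) simp
  then show ?thesis by (simp add: energy_def map_graph_def multiset.map_comp o_def)
qed

lemma energy_union_graph: "energy (union_graph g h) f k = energy g f k + energy h f k"
  by (simp add: energy_def union_graph_def)

lemma energy_commute: "energy g f k = energy g k f"
proof -
  have "edge_form f k e = edge_form k f e" for e by (cases e) simp
  then show ?thesis by (simp add: energy_def)
qed

lemma energy_add_left: "energy g (\<lambda>x. f x + f' x) k = energy g f k + energy g f' k"
proof -
  have "edge_form (\<lambda>x. f x + f' x) k e = edge_form f k e + edge_form f' k e" for e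
    by (cases e) (simp add: algebra_simps)
  then show ?thesis by (simp add: energy_def sum_mset.distrib)
qed

lemma energy_scale_left: "energy g (\<lambda>x. c * f x) k = c * energy g f k"
proof -
  have "edge_form (\<lambda>x. c * f x) k e = c * edge_form f k e" for e
    by (cases e) (simp add: algebra_simps)
  then show ?thesis by (simp add: energy_def sum_mset_distrib_left)
qed

lemma energy_nonneg: "energy g f f \<ge> 0"
proof -
  have "edge_form f f e \<ge> 0" for e by (cases e) simp
  then show ?thesis using sum_mset_mono[of "edges g" "\<lambda>_. 0" "edge_form f f"] by (simp add: energy_def)
qed

definition wf_graph :: "'a multigraph \<Rightarrow> bool" where
  "wf_graph g \<longleftrightarrow> finite (verts g) \<and> (\<forall>e\<in>#edges g. set_uprod e \<subseteq> verts g)"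

lemma wf_map_graph: "wf_graph g \<Longrightarrow> wf_graph (map_graph h g)"
  by (auto simp: wf_graph_def map_graph_def uprod.set_map)

lemma wf_union_graph: "wf_graph g \<Longrightarrow> wf_graph h \<Longrightarrow> wf_graph (union_graph g h)"
  by (auto simp: wf_graph_def union_graph_def)

lemma energy_cong:
  assumes "wf_graph g" "\<And>x. x \<in> verts g \<Longrightarrow> f x = f' x" "\<And>x. x \<in> verts g \<Longrightarrow> k x = k' x"
  shows "energy g f k = energy g f' k'"
proof -
  have "edge_form f k e = edge_form f' k' e" if "e \<in># edges g" for e
  proof (cases e)
    case (Upair a b)
    then have "a \<in> verts g" "b \<in> verts g" using assms(1) that by (auto simp: wf_graph_def)
    then show ?thesis using assms Upair by simp
  qed
  then show ?thesis by (auto simp: energy_def intro!: arg_cong[where f = sum_mset] image_mset_cong)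
qed

text \<open>Summation by parts. Both sides are additive in the multiset of edges, so edges are added
  one at a time.\<close>

lemma sum_laplacian:
  assumes "wf_graph g"
  shows "(\<Sum>x\<in>verts g. k x * laplacian g f x) = energy g f k"
proof -
  have "(\<Sum>x\<in>V. k x * (\<Sum>y\<in>V. real (count E (Upair x y)) * (f x - f y))) =
      (\<Sum>e\<in>#E. edge_form f k e)"
    if "finite V" "\<forall>e\<in>#E. set_uprod e \<subseteq> V" for V :: "'a set" and E
    using that(2)
  proof (induction E)
    case empty
    then show ?case by simp
  next
    case (add e E)
    obtain a b where e: "e = Upair a b" by (cases e)
    then have ab: "a \<in> V" "b \<in> V" using add.prems by auto
    \<comment> \<open>The difference of the two indicators also covers a loop, where both sides
      vanish.\<close>
    have inner: "(\<Sum>y\<in>V. of_bool (Upair x y = e) * (f x - f y)) = (f a - f b) * (of_bool (x = a) - of_bool (x = b))"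
      if "x \<in> V" for x
    proof (cases "x = a")
      case True
      have "(\<Sum>y\<in>V. of_bool (Upair x y = e) * (f x - f y)) = (\<Sum>y\<in>V. if y = b then f a - f b else 0)"
        using True e by (intro sum.cong) auto
      also have "\<dots> = f a - f b" using ab \<open>finite V\<close> by simp
      finally show ?thesis using True by (cases "a = b") (simp_all del: sum_of_bool_mult_eq)
    next
      case False
      have "(\<Sum>y\<in>V. of_bool (Upair x y = e) * (f x - f y)) = (\<Sum>y\<in>V. if y = a then of_bool (x = b) * (f b - f a) else 0)"
        using False e by (intro sum.cong) auto
      then show ?thesis using ab \<open>finite V\<close> False by (simp add: algebra_simps)
    qed
    have "(\<Sum>x\<in>V. k x * (\<Sum>y\<in>V. real (count (add_mset e E) (Upair x y)) * (f x - f y))) =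
      (\<Sum>x\<in>V. k x * ((\<Sum>y\<in>V. of_bool (Upair x y = e) * (f x - f y))
         + (\<Sum>y\<in>V. real (count E (Upair x y)) * (f x - f y))))"
      by (subst sum.distrib[symmetric]) (auto intro!: sum.cong simp: algebra_simps)
    also have "\<dots> = (\<Sum>x\<in>V. k x * ((f a - f b) * (of_bool (x = a) - of_bool (x = b)))) +
        (\<Sum>x\<in>V. k x * (\<Sum>y\<in>V. real (count E (Upair x y)) * (f x - f y)))"
      by (simp only: distrib_left sum.distrib inner cong: sum.cong)
    also have "(\<Sum>x\<in>V. k x * ((f a - f b) * (of_bool (x = a) - of_bool (x = b)))) =
       (\<Sum>x\<in>V. if x = a then k x * (f a - f b) else 0) - (\<Sum>x\<in>V. if x = b then k x * (f a - f b) else 0)"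
      by (subst sum_subtractf[symmetric]) (auto intro!: sum.cong simp: algebra_simps)
    also have "\<dots> = edge_form f k e" using ab \<open>finite V\<close> by (simp add: e algebra_simps)
    finally show ?case using add by simp
  qed
  from this[of "verts g" "edges g"] show ?thesis
    using assms by (simp add: laplacian_def energy_def wf_graph_def)
qed

lemma laplacian_eq_energy:
  assumes "wf_graph g" "x \<in> verts g"
  shows "laplacian g f x = energy g f (\<lambda>y. of_bool (y = x))"
proof -
  have "energy g f (\<lambda>y. of_bool (y = x)) = (\<Sum>y\<in>verts g. if y = x then laplacian g f y else 0)"
    by (subst sum_laplacian[OF assms(1), symmetric], rule sum.cong) auto
  then show ?thesis using assms by (simp add: wf_graph_def)
qed

text \<open>Truncated subtraction lets one rule cover all levels: for \<open>n = 0\<close> all three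
  copies are \<open>G 0\<close>, and the middle edge, with both ends at \<open>Ctr\<close>, is the
  loop of \<open>G 1\<close>. \<open>\<Gamma>_eq\<close> and \<open>G_induct\<close> rest on the
  same convention.\<close>

lemma G_Suc:
  "G (Suc n) = union_graph (map_graph (place Ctr Ctr Cp3) (G n))
    (union_graph (map_graph (place Bd1 Ctr Cp1) (G (n - 1))) (map_graph (place Ctr Bd2 Cp2) (G (n - 1))))"
  by (cases n) (auto simp: union_graph_def map_graph_def)

lemma \<Gamma>_eq:
  "\<Gamma> n = union_graph (map_graph (place Ctr Ctr Cp1) (G n)) (map_graph (place Ctr Ctr Cp2) (G (n - 1)))"
  by (cases n) (auto simp: union_graph_def map_graph_def)

lemma G_induct [case_names 0 Suc]:
  assumes "P 0" "\<And>n. P n \<Longrightarrow> P (n - 1) \<Longrightarrow> P (Suc n)"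
  shows "P n"
proof (induction n rule: less_induct)
  case (less n)
  then show ?case using assms by (cases n) auto
qed

lemma wf_G: "wf_graph (G n)"
proof (induction n rule: G_induct)
  case 0
  then show ?case by (simp add: wf_graph_def)
next
  case (Suc n)
  then show ?case unfolding G_Suc by (intro wf_union_graph wf_map_graph)
qed

lemma wf_\<Gamma>: "wf_graph (\<Gamma> n)"
  unfolding \<Gamma>_eq by (intro wf_union_graph wf_map_graph wf_G)

definition inner_verts :: "nat \<Rightarrow> addr set" where
  "inner_verts n = verts (G n) - {Bd1, Bd2}"

lemma finite_inner_verts [simp]: "finite (inner_verts n)"
  by (simp add: inner_verts_def finite_verts_G)

lemma inner_verts_0 [simp]: "inner_verts 0 = {}"
  by (simp add: inner_verts_def)

lemma Bd_notin_inner_verts [simp]: "Bd1 \<notin> inner_verts n" "Bd2 \<notin> inner_verts n"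
  by (simp_all add: inner_verts_def)

lemma verts_G: "verts (G n) = {Bd1, Bd2} \<union> inner_verts n"
  using Bd_in_verts_G[of n] by (auto simp: inner_verts_def)

lemma inner_verts_Suc:
  "inner_verts (Suc n) =
    insert Ctr (Cp3 ` inner_verts n \<union> (Cp1 ` inner_verts (n - 1) \<union> Cp2 ` inner_verts (n - 1)))"
  unfolding inner_verts_def G_Suc by (auto simp: map_graph_def union_graph_def place_image_G)

lemma verts_\<Gamma>: "verts (\<Gamma> n) = insert Ctr (Cp1 ` inner_verts n \<union> Cp2 ` inner_verts (n - 1))"
  unfolding inner_verts_def \<Gamma>_eq by (auto simp: map_graph_def union_graph_def place_image_G)

section \<open>Weak form of the eigenvalue equation\<close>

definition ip :: "nat \<Rightarrow> (addr \<Rightarrow> real) \<Rightarrow> (addr \<Rightarrow> real) \<Rightarrow> real" where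
  "ip n f k = (\<Sum>x\<in>inner_verts n. f x * k x)"

lemma ip_nonneg: "ip n f f \<ge> 0"
  unfolding ip_def by (intro sum_nonneg) auto

lemma ip_eq_0_iff: "ip n f f = 0 \<longleftrightarrow> (\<forall>x\<in>inner_verts n. f x = 0)"
  unfolding ip_def by (subst sum_nonneg_eq_0_iff) auto

lemma ip_zeroD: "ip n f f = 0 \<Longrightarrow> ip n f k = 0"
  unfolding ip_eq_0_iff by (simp add: ip_def)

text \<open>Boundary vertices carry no mass, so gluing creates exactly one new mass term, the one at
  \<open>Ctr\<close> in \<open>form_Suc\<close>.\<close>

definition form :: "nat \<Rightarrow> real \<Rightarrow> (addr \<Rightarrow> real) \<Rightarrow> (addr \<Rightarrow> real) \<Rightarrow> real" where
  "form n t f k = energy (G n) f k - t * ip n f k"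

abbreviation on1 :: "(addr \<Rightarrow> real) \<Rightarrow> addr \<Rightarrow> real" where
  "on1 f \<equiv> \<lambda>x. f (place Bd1 Ctr Cp1 x)"
abbreviation on2 :: "(addr \<Rightarrow> real) \<Rightarrow> addr \<Rightarrow> real" where
  "on2 f \<equiv> \<lambda>x. f (place Ctr Bd2 Cp2 x)"
abbreviation on3 :: "(addr \<Rightarrow> real) \<Rightarrow> addr \<Rightarrow> real" where
  "on3 f \<equiv> \<lambda>x. f (place Ctr Ctr Cp3 x)"

lemma place_inner_verts: "x \<in> inner_verts n \<Longrightarrow> place p q i x = i x"
  by (cases x) auto

lemma sum_inner_verts_Suc:
  "(\<Sum>x\<in>inner_verts (Suc n). h x) = h Ctr + (\<Sum>x\<in>inner_verts n. h (Cp3 x)) +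
    (\<Sum>x\<in>inner_verts (n - 1). h (Cp1 x)) + (\<Sum>x\<in>inner_verts (n - 1). h (Cp2 x))"
proof -
  have "(\<Sum>x\<in>inner_verts (Suc n). h x) = h Ctr + (sum h (Cp3 ` inner_verts n) +
    (sum h (Cp1 ` inner_verts (n - 1)) + sum h (Cp2 ` inner_verts (n - 1))))"
    unfolding inner_verts_Suc
    by (subst sum.insert, simp, force) (subst sum.union_disjoint, simp, simp, force,
        subst sum.union_disjoint, simp, simp, force, simp)
  then show ?thesis by (simp add: sum.reindex inj_on_def add.assoc)
qed

lemma ip_Suc:
  "ip (Suc n) f k = f Ctr * k Ctr + ip n (on3 f) (on3 k) + ip (n - 1) (on1 f) (on1 k) +
    ip (n - 1) (on2 f) (on2 k)"
  unfolding ip_def sum_inner_verts_Suc by (simp add: place_inner_verts)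

lemma form_Suc:
  "form (Suc n) t f k = form n t (on3 f) (on3 k) + form (n - 1) t (on1 f) (on1 k) +
    form (n - 1) t (on2 f) (on2 k) - t * f Ctr * k Ctr"
  unfolding form_def ip_Suc
  by (simp add: G_Suc energy_map_graph energy_union_graph algebra_simps del: G.simps)

lemma ip_commute: "ip n f k = ip n k f"
  by (simp add: ip_def mult.commute)

lemma ip_add_left: "ip n (\<lambda>x. f x + f' x) k = ip n f k + ip n f' k"
  by (simp add: ip_def algebra_simps sum.distrib)

lemma ip_scale_left: "ip n (\<lambda>x. c * f x) k = c * ip n f k"
  by (simp add: ip_def algebra_simps sum_distrib_left)

lemma form_commute: "form n t f k = form n t k f"
  unfolding form_def by (simp add: energy_commute[of _ f] ip_commute[of _ f])

lemma form_add_left: "form n t (\<lambda>x. f x + f' x) k = form n t f k + form n t f' k"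
  by (simp add: form_def energy_add_left ip_add_left algebra_simps)

lemma form_scale_left: "form n t (\<lambda>x. c * f x) k = c * form n t f k"
  by (simp add: form_def energy_scale_left ip_scale_left algebra_simps)

lemma form_add_right: "form n t k (\<lambda>x. f x + f' x) = form n t k f + form n t k f'"
  using form_add_left[of n t f f' k] by (simp add: form_commute)

lemma form_scale_right: "form n t k (\<lambda>x. c * f x) = c * form n t k f"
  using form_scale_left[of n t c f k] by (simp add: form_commute)

lemma form_cong:
  assumes "\<And>x. x \<in> verts (G n) \<Longrightarrow> f x = f' x" "\<And>x. x \<in> verts (G n) \<Longrightarrow> k x = k' x"
  shows "form n t f k = form n t f' k'"
proof -
  have "energy (G n) f k = energy (G n) f' k'" using assms by (intro energy_cong wf_G)
  moreover have "ip n f k = ip n f' k'"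
    using assms by (auto simp: ip_def inner_verts_def intro!: sum.cong)
  ultimately show ?thesis by (simp add: form_def)
qed

lemma form_0: "form 0 t f k = (f Bd1 - f Bd2) * (k Bd1 - k Bd2)"
  by (simp add: form_def energy_def ip_def)

text \<open>The constant 8 is twice the degree 4 of an inner vertex, a loop counting twice; boundary
  vertices have degree 1. In the induction the four ends glued at \<open>Ctr\<close> contribute 2
  each.\<close>

lemma energy_le: "energy (G n) f f \<le> 2 * (f Bd1)\<^sup>2 + 2 * (f Bd2)\<^sup>2 + 8 * ip n f f"
proof (induction n arbitrary: f rule: G_induct)
  case 0
  have "(f Bd1 - f Bd2)\<^sup>2 \<le> 2 * (f Bd1)\<^sup>2 + 2 * (f Bd2)\<^sup>2"
    using zero_le_power2[of "f Bd1 + f Bd2"] by (simp add: power2_eq_square algebra_simps)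
  then show ?case by (simp add: energy_def ip_def power2_eq_square)
next
  case (Suc n)
  show ?case
    using Suc(1)[of "on3 f"] Suc(2)[of "on1 f"] Suc(2)[of "on2 f"] unfolding ip_Suc
    by (simp add: G_Suc energy_map_graph energy_union_graph power2_eq_square algebra_simps del: G.simps)
qed

text \<open>Tested against every \<open>k\<close>, this says that \<open>f\<close> solves the
  eigenvalue equation at the inner vertices, and that \<open>j1\<close> and \<open>j2\<close> are
  the values of its Laplacian, the fluxes, at \<open>Bd1\<close> and \<open>Bd2\<close>.\<close>

definition response :: "nat \<Rightarrow> real \<Rightarrow> (addr \<Rightarrow> real) \<Rightarrow> real \<Rightarrow> real \<Rightarrow> bool" where
  "response n t f j1 j2 \<longleftrightarrow> (\<forall>k. form n t f k = j1 * k Bd1 + j2 * k Bd2)"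

lemma responseD: "response n t f j1 j2 \<Longrightarrow> form n t f k = j1 * k Bd1 + j2 * k Bd2"
  by (simp add: response_def)

lemma response_exists:
  assumes "\<And>k. k Bd1 = 0 \<Longrightarrow> k Bd2 = 0 \<Longrightarrow> form n t f k = 0"
  obtains j1 j2 where "response n t f j1 j2"
proof
  let ?d = "\<lambda>b x. of_bool (x = b) :: real"
  show "response n t f (form n t f (?d Bd1)) (form n t f (?d Bd2))"
    unfolding response_def
  proof
    fix k
    let ?k = "\<lambda>x. k x + (- k Bd1 * ?d Bd1 x + - k Bd2 * ?d Bd2 x)"
    have "form n t f ?k = 0" by (rule assms) auto
    then show "form n t f k = form n t f (?d Bd1) * k Bd1 + form n t f (?d Bd2) * k Bd2"
      by (simp only: form_add_right form_scale_right) (simp add: algebra_simps)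
  qed
qed

section \<open>Gluing and splitting solutions\<close>

fun join :: "(addr \<Rightarrow> real) \<Rightarrow> (addr \<Rightarrow> real) \<Rightarrow> (addr \<Rightarrow> real) \<Rightarrow> addr \<Rightarrow> real" where
  "join f1 f2 f3 Bd1 = f1 Bd1"
| "join f1 f2 f3 Bd2 = f2 Bd2"
| "join f1 f2 f3 Ctr = f1 Bd2"
| "join f1 f2 f3 (Cp1 x) = f1 x"
| "join f1 f2 f3 (Cp2 x) = f2 x"
| "join f1 f2 f3 (Cp3 x) = f3 x"

lemma on1_join [simp]: "on1 (join f1 f2 f3) = f1"
proof
  show "on1 (join f1 f2 f3) x = f1 x" for x by (cases x) auto
qed

lemma on2_join [simp]: "f2 Bd1 = f1 Bd2 \<Longrightarrow> on2 (join f1 f2 f3) = f2"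
proof
  show "on2 (join f1 f2 f3) x = f2 x" if "f2 Bd1 = f1 Bd2" for x using that by (cases x) auto
qed

lemma on3_join [simp]: "f3 Bd1 = f1 Bd2 \<Longrightarrow> f3 Bd2 = f1 Bd2 \<Longrightarrow> on3 (join f1 f2 f3) = f3"
proof
  show "on3 (join f1 f2 f3) x = f3 x" if "f3 Bd1 = f1 Bd2" "f3 Bd2 = f1 Bd2" for x
    using that by (cases x) auto
qed

text \<open>The last hypothesis is the eigenvalue equation at \<open>Ctr\<close>: the four fluxes
  meeting there add up to the Laplacian.\<close>

lemma response_glue:
  assumes "response (n - 1) t (on1 f) j1 b" "response (n - 1) t (on2 f) c j2"
    "response n t (on3 f) l1 l2" "l1 + l2 + b + c = t * f Ctr"
  shows "response (Suc n) t f j1 j2"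
  unfolding response_def
proof
  fix k
  show "form (Suc n) t f k = j1 * k Bd1 + j2 * k Bd2"
    unfolding form_Suc responseD[OF assms(1)] responseD[OF assms(2)] responseD[OF assms(3)]
      assms(4)[symmetric] by (simp add: algebra_simps)
qed

lemma form_zero_right [simp]: "form n t f (\<lambda>_. 0) = 0"
  using form_scale_right[of n t f 0 f] by simp

lemma response_split:
  assumes "response (Suc n) t f j1 j2"
  obtains b c l1 l2 where "response (n - 1) t (on1 f) j1 b" "response (n - 1) t (on2 f) c j2"
    "response n t (on3 f) l1 l2" "l1 + l2 + b + c = t * f Ctr"
proof -
  have test: "form n t (on3 f) k3 + form (n - 1) t (on1 f) k1 + form (n - 1) t (on2 f) k2
      - t * f Ctr * k1 Bd2 = j1 * k1 Bd1 + j2 * k2 Bd2"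
    if "k2 Bd1 = k1 Bd2" "k3 Bd1 = k1 Bd2" "k3 Bd2 = k1 Bd2" for k1 k2 k3
    using responseD[OF assms, of "join k1 k2 k3"] that unfolding form_Suc by simp
  \<comment> \<open>Test functions living on one copy isolate that copy. The indicators below then
    read off the outer fluxes, and a function equal to 1 at the centre and 0 at the outer boundary
    gives the balance.\<close>
  obtain l1 l2 where 3: "response n t (on3 f) l1 l2"
    using test[of "\<lambda>_. 0" "\<lambda>_. 0"] by (rule_tac response_exists) auto
  obtain i1 b where 1: "response (n - 1) t (on1 f) i1 b"
    using test[of "\<lambda>_. 0" _ "\<lambda>_. 0"] by (rule_tac response_exists) auto
  obtain c i2 where 2: "response (n - 1) t (on2 f) c i2"
    using test[of _ "\<lambda>_. 0" "\<lambda>_. 0"] by (rule_tac response_exists) auto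
  let ?d = "\<lambda>b x. of_bool (x = b) :: real"
  have "i1 = j1"
    using test[of "\<lambda>_. 0" "?d Bd1" "\<lambda>_. 0"] by (simp add: responseD[OF 1] del: One_nat_def)
  moreover have "i2 = j2"
    using test[of "?d Bd2" "\<lambda>_. 0" "\<lambda>_. 0"] by (simp add: responseD[OF 2] del: One_nat_def)
  moreover have "l1 + l2 + b + c = t * f Ctr"
    using test[of "?d Bd1" "?d Bd2" "\<lambda>_. 1"]
    by (simp add: responseD[OF 1] responseD[OF 2] responseD[OF 3] del: One_nat_def)
  ultimately show thesis using that 1 2 3 by simp
qed

lemma response_join:
  assumes "response (n - 1) t f1 j1 b" "response (n - 1) t f2 c j2" "response n t f3 l1 l2"
    "f1 Bd2 = z" "f2 Bd1 = z" "f3 Bd1 = z" "f3 Bd2 = z" "l1 + l2 + b + c = t * z"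
  shows "response (Suc n) t (join f1 f2 f3) j1 j2"
proof (rule response_glue)
  show "response (n - 1) t (on1 (join f1 f2 f3)) j1 b" unfolding on1_join by fact
  have "on2 (join f1 f2 f3) = f2" "on3 (join f1 f2 f3) = f3" using assms by simp_all
  then show "response (n - 1) t (on2 (join f1 f2 f3)) c j2"
    "response n t (on3 (join f1 f2 f3)) l1 l2" using assms(2,3) by (simp_all only:)
  show "l1 + l2 + b + c = t * join f1 f2 f3 Ctr" using assms by simp
qed

lemmas response_join_Suc = response_join[of "Suc n" for n, unfolded diff_Suc_1]

text \<open>Symmetry of the form. Pairing with a suitable comparison solution determines fluxes or
  forces them to vanish.\<close>

lemma response_Green:
  assumes "response n t f j1 j2" "response n t h i1 i2"
  shows "j1 * h Bd1 + j2 * h Bd2 = i1 * f Bd1 + i2 * f Bd2"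
  using responseD[OF assms(1), of h] responseD[OF assms(2), of f] by (simp add: form_commute)

lemma response_zero [simp]: "response n t (\<lambda>_. 0) 0 0"
  unfolding response_def by (subst form_commute) simp

lemma response_add:
  "response n t f j1 j2 \<Longrightarrow> response n t h i1 i2 \<Longrightarrow>
    response n t (\<lambda>x. f x + h x) (j1 + i1) (j2 + i2)"
  by (simp add: response_def form_add_left algebra_simps)

lemma response_scale: "response n t f j1 j2 \<Longrightarrow> response n t (\<lambda>x. c * f x) (c * j1) (c * j2)"
  by (simp add: response_def form_scale_left algebra_simps)

lemma response_cong:
  assumes "response n t f j1 j2" "\<And>x. x \<in> verts (G n) \<Longrightarrow> f x = f' x"
  shows "response n t f' j1 j2"
  using assms form_cong[of n f f'] unfolding response_def by metis

section \<open>Approximate eigenvectors\<close>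

text \<open>Functions carry the product topology; vanishing off \<open>X\<close> puts the sphere
  into a product of compact sets, where it is closed.\<close>

lemma compact_unit_sphere_on:
  assumes "finite X"
  shows "compact {g :: 'a \<Rightarrow> real. (\<forall>x. x \<notin> X \<longrightarrow> g x = 0) \<and> (\<Sum>x\<in>X. g x * g x) = 1}"
proof -
  have "compactin (product_topology (\<lambda>_. euclidean) UNIV) (PiE UNIV (\<lambda>x. if x \<in> X then {-1..1::real} else {0}))"
    by (subst compactin_PiE) auto
  then have "compact (PiE UNIV (\<lambda>x. if x \<in> X then {-1..1::real} else {0}))"
    by (simp add: euclidean_product_topology)
  moreover have "closed {g :: 'a \<Rightarrow> real. (\<Sum>x\<in>X. g x * g x) = 1}"
    by (intro closed_Collect_eq continuous_intros continuous_on_product_coordinates)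
  ultimately have "compact ({g. (\<Sum>x\<in>X. g x * g x) = 1} \<inter> PiE UNIV (\<lambda>x. if x \<in> X then {-1..1::real} else {0}))"
    by (rule closed_Int_compact[rotated])
  also have "{g. (\<Sum>x\<in>X. g x * g x) = 1} \<inter> PiE UNIV (\<lambda>x. if x \<in> X then {-1..1::real} else {0}) =
    {g. (\<forall>x. x \<notin> X \<longrightarrow> g x = 0) \<and> (\<Sum>x\<in>X. g x * g x) = 1}" (is "?A = ?B")
  proof
    show "?B \<subseteq> ?A"
    proof clarify
      fix g :: "'a \<Rightarrow> real" assume g: "\<forall>x. x \<notin> X \<longrightarrow> g x = 0" "(\<Sum>x\<in>X. g x * g x) = 1"
      have "g x \<in> {-1..1}" if "x \<in> X" for x
      proof -
        have "g x * g x \<le> (\<Sum>x\<in>X. g x * g x)"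
          using that assms by (intro member_le_sum) auto
        then have "(g x)\<^sup>2 \<le> 1" using g by (simp add: power2_eq_square)
        then have "\<bar>g x\<bar> \<le> 1" by (simp add: abs_square_le_1)
        then show ?thesis by (simp add: abs_le_iff)
      qed
      then show "g \<in> ?A" using g by (auto simp: PiE_def)
    qed
    show "?A \<subseteq> ?B" by (auto simp: PiE_def Pi_def split: if_splits)
  qed
  finally show ?thesis .
qed

text \<open>The eigenvector is found from a minimiser of \<open>\<parallel>M g\<parallel>\<close> on the unit sphere of the
  orthogonal complement of the kernel, which is an eigenvector of \<open>M\<^sup>2\<close>.\<close>

lemma symmetric_matrix_approx_eigenvector:
  fixes M :: "'a \<Rightarrow> 'a \<Rightarrow> real"
  assumes X: "finite X" and sym: "\<And>x y. M x y = M y x"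
  defines "L \<equiv> \<lambda>f x. \<Sum>y\<in>X. M x y * f y"
  assumes v: "(\<Sum>x\<in>X. v x * v x) > 0"
    and ker: "\<And>f. (\<forall>x\<in>X. L f x = 0) \<Longrightarrow> (\<Sum>x\<in>X. f x * v x) = 0"
  obtains f s where "\<And>x. x \<notin> X \<Longrightarrow> f x = 0" "(\<Sum>x\<in>X. f x * f x) > 0" "s \<noteq> 0"
    "s\<^sup>2 * (\<Sum>x\<in>X. v x * v x) \<le> (\<Sum>x\<in>X. (L v x)\<^sup>2)" "\<And>x. x \<in> X \<Longrightarrow> L f x = s * f x"
proof -
  let ?dot = "\<lambda>f g. \<Sum>x\<in>X. f x * g x :: real"
  have Ladd: "L (\<lambda>x. f x + g x) = (\<lambda>x. L f x + L g x)" for f g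
    by (auto simp: L_def algebra_simps sum.distrib)
  have Lscale: "L (\<lambda>x. c * f x) = (\<lambda>x. c * L f x)" for c f
    by (auto simp: L_def algebra_simps sum_distrib_left)
  have Lsym: "?dot (L f) g = ?dot f (L g)" for f g
  proof -
    have "?dot (L f) g = (\<Sum>x\<in>X. \<Sum>y\<in>X. M x y * f y * g x)"
      by (simp add: L_def sum_distrib_right)
    also have "\<dots> = (\<Sum>y\<in>X. \<Sum>x\<in>X. M x y * f y * g x)" by (rule sum.swap)
    also have "\<dots> = ?dot f (L g)"
      unfolding L_def sum_distrib_left by (intro sum.cong refl) (simp add: sym mult_ac)
    finally show ?thesis .
  qed
  have dot_lin: "?dot f (\<lambda>x. g x + c * h x) = ?dot f g + c * ?dot f h"
    "?dot (\<lambda>x. g x + c * h x) f = ?dot g f + c * ?dot h f" for f g h c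
    by (simp_all add: algebra_simps sum.distrib sum_distrib_left)
  have dot_comm: "?dot f g = ?dot g f" for f g
    by (simp add: mult.commute)
  have pos: "?dot f f \<ge> 0" for f by (intro sum_nonneg) auto
  have zero: "f x = 0" if "?dot f f = 0" "x \<in> X" for f x
    using that X by (subst (asm) sum_nonneg_eq_0_iff) auto
  define S where "S = {g. (\<forall>x. x \<notin> X \<longrightarrow> g x = 0) \<and> ?dot g g = 1} \<inter>
    {g. \<forall>f. (\<forall>x\<in>X. L f x = 0) \<longrightarrow> ?dot f g = 0}"
  have "closed {g. \<forall>f. (\<forall>x\<in>X. L f x = 0) \<longrightarrow> ?dot f g = 0}"
    unfolding Collect_all_eq Collect_imp_eq
    by (intro closed_INT closed_Un ballI)
      (auto intro!: closed_Collect_eq continuous_intros continuous_on_product_coordinates)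
  then have "compact S"
    unfolding S_def by (intro compact_Int_closed compact_unit_sphere_on X)
  have normalize: "(\<lambda>x. if x \<in> X then g x / sqrt (?dot g g) else 0) \<in> S"
    if "?dot g g > 0" "\<And>f. (\<forall>x\<in>X. L f x = 0) \<Longrightarrow> ?dot f g = 0" for g
  proof -
    have "(\<Sum>x\<in>X. (g x / sqrt (?dot g g)) * (g x / sqrt (?dot g g))) = ?dot g g / ?dot g g"
      using that(1) by (simp add: sum_divide_distrib[symmetric])
    then have "(\<Sum>x\<in>X. (g x / sqrt (?dot g g)) * (g x / sqrt (?dot g g))) = 1"
      using that(1) by simp
    moreover have "(\<Sum>x\<in>X. f x * (g x / sqrt (?dot g g))) = 0" if "\<forall>x\<in>X. L f x = 0" for f
    proof -
      have "(\<Sum>x\<in>X. f x * (g x / sqrt (?dot g g))) = ?dot f g / sqrt (?dot g g)"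
        by (simp add: sum_divide_distrib[symmetric])
      then show ?thesis using \<open>\<And>f. (\<forall>x\<in>X. L f x = 0) \<Longrightarrow> ?dot f g = 0\<close>[OF that] by simp
    qed
    ultimately show ?thesis by (auto simp: S_def cong: sum.cong)
  qed
  define R where "R g = ?dot (L g) (L g)" for g
  have "continuous_on S R"
    unfolding R_def L_def
    by (intro continuous_intros continuous_on_subset[OF continuous_on_product_coordinates] subset_UNIV)
  moreover have "S \<noteq> {}" using normalize[OF v ker] by auto
  ultimately obtain g where g: "g \<in> S" and gmin: "\<And>h. h \<in> S \<Longrightarrow> R g \<le> R h"
    using \<open>compact S\<close> continuous_attains_inf[of S R] by metis
  have gg: "?dot g g = 1" "\<And>x. x \<notin> X \<Longrightarrow> g x = 0"
    and gker: "\<And>f. (\<forall>x\<in>X. L f x = 0) \<Longrightarrow> ?dot f g = 0"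
    using g by (auto simp: S_def)
  \<comment> \<open>By homogeneity the minimum property extends from \<open>S\<close> to the whole
    complement of the kernel.\<close>
  have Rmin: "R g * ?dot h h \<le> R h"
    if hk: "\<And>f. (\<forall>x\<in>X. L f x = 0) \<Longrightarrow> ?dot f h = 0" for h
  proof (cases "?dot h h > 0")
    case True
    let ?c = "1 / sqrt (?dot h h)"
    have "R g \<le> R (\<lambda>x. if x \<in> X then h x / sqrt (?dot h h) else 0)"
      by (intro gmin normalize True hk)
    also have "L (\<lambda>x. if x \<in> X then h x / sqrt (?dot h h) else 0) = L (\<lambda>x. ?c * h x)"
      by (auto simp: L_def intro!: sum.cong)
    then have "R (\<lambda>x. if x \<in> X then h x / sqrt (?dot h h) else 0) = (?c * ?c) * R h"
      unfolding R_def Lscale by (simp add: sum_distrib_left sum_divide_distrib mult_ac)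
    also have "\<dots> = R h / ?dot h h" using True by simp
    finally show ?thesis using True by (simp add: field_simps)
  next
    case False
    then have "?dot h h = 0" using pos[of h] by linarith
    then show ?thesis using pos[of "L h"] by (simp add: R_def)
  qed
  define r where "r = R g"
  \<comment> \<open>Up to a factor 2, \<open>u\<close> is the gradient of the Rayleigh quotient at
    \<open>g\<close>. It stays in the complement of the kernel, so \<open>g + e * u\<close> is an
    admissible variation.\<close>
  define u where "u = (\<lambda>x. L (L g) x + - r * g x)"
  have uker: "?dot f u = 0" if "\<forall>x\<in>X. L f x = 0" for f
  proof -
    have "?dot f u = ?dot f (L (L g)) + - r * ?dot f g"
      unfolding u_def by (rule dot_lin)
    also have "?dot f (L (L g)) = ?dot (L f) (L g)" by (simp add: Lsym)
    finally show ?thesis using gker[OF that] that by simp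
  qed
  have "?dot u u = 0"
  proof (rule ccontr)
    assume "?dot u u \<noteq> 0"
    then have upos: "?dot u u > 0" using pos[of u] by linarith
    have cross: "?dot (L g) (L u) - r * ?dot g u = ?dot u u"
    proof -
      have "?dot (L g) (L u) = ?dot (L (L g)) u" by (rule Lsym[symmetric])
      moreover have "?dot u u = ?dot (L (L g)) u + - r * ?dot g u"
        using dot_lin(2)[of "L (L g)" "- r" g u] by (simp only: u_def)
      ultimately show ?thesis by simp
    qed
    have "0 \<le> 2 * e * ?dot u u + e\<^sup>2 * (R u - r * ?dot u u)" for e
    proof -
      let ?h = "\<lambda>x. g x + e * u x"
      have "?dot f ?h = 0" if "\<forall>x\<in>X. L f x = 0" for f
      proof -
        have "?dot f ?h = ?dot f g + e * ?dot f u" by (rule dot_lin)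
        then show ?thesis using gker[OF that] uker[OF that] by simp
      qed
      then have "r * ?dot ?h ?h \<le> R ?h" unfolding r_def by (rule Rmin)
      moreover have "?dot ?h ?h = 1 + 2 * e * ?dot g u + e\<^sup>2 * ?dot u u"
        unfolding dot_lin gg(1) dot_comm[of u g] by algebra
      moreover have "R ?h = r + 2 * e * ?dot (L g) (L u) + e\<^sup>2 * R u"
        unfolding R_def r_def Ladd Lscale dot_lin
          dot_comm[of "L u" "L g"] by algebra
      ultimately have "r * (1 + 2 * e * ?dot g u + e\<^sup>2 * ?dot u u) \<le>
        r + 2 * e * (?dot u u + r * ?dot g u) + e\<^sup>2 * R u"
        using cross by (simp add: algebra_simps)
      then show ?thesis by (simp add: algebra_simps)
    qed
    moreover define p q where "p = ?dot u u" and "q = R u - r * ?dot u u"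
    ultimately have q: "0 \<le> 2 * e * p + e\<^sup>2 * q" for e by simp
    have "p > 0" using upos p_def by simp
    \<comment> \<open>For this \<open>e\<close> the quadratic term makes up for at most half of the
      linear one, which is negative.\<close>
    define e where "e = - p / (\<bar>q\<bar> + 1)"
    have "0 \<le> 2 * e * p + e\<^sup>2 * q" by (rule q)
    also have "e\<^sup>2 * q \<le> e\<^sup>2 * (\<bar>q\<bar> + 1)" by (intro mult_left_mono) auto
    also have "e\<^sup>2 * (\<bar>q\<bar> + 1) = - e * p" by (simp add: e_def power2_eq_square)
    finally have "0 \<le> e * p" by simp
    moreover have "e < 0" using \<open>p > 0\<close> by (simp add: e_def divide_neg_pos)
    ultimately show False using \<open>p > 0\<close> by (simp add: zero_le_mult_iff)
  qed
  then have LL: "L (L g) x = r * g x" if "x \<in> X" for x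
    using zero[of u x] that by (simp add: u_def)
  have "r \<noteq> 0"
  proof
    assume "r = 0"
    then have "\<forall>x\<in>X. L g x = 0" using zero[of "L g"] by (simp add: r_def R_def)
    then show False using gker[of g] gg by simp
  qed
  moreover have "r \<ge> 0" using pos[of "L g"] by (simp add: r_def R_def)
  ultimately have rpos: "r > 0" by simp
  define s where "s = sqrt r"
  have s: "s > 0" "s\<^sup>2 = r" "s * s = r" using rpos by (simp_all add: s_def)
  have bound: "s\<^sup>2 * ?dot v v \<le> (\<Sum>x\<in>X. (L v x)\<^sup>2)"
    using Rmin[of v, OF ker] s by (simp add: r_def R_def power2_eq_square)
  \<comment> \<open>The product (L - s)(L + s) annihilates \<open>g\<close>: either (L + s) g is an
    eigenvector for \<open>s\<close>, or it is zero and \<open>g\<close> is one for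
    \<open>- s\<close>.\<close>
  define u where "u = (\<lambda>x. if x \<in> X then L g x + s * g x else 0)"
  have "?dot u u > 0 \<or> ?dot u u = 0" using pos[of u] by linarith
  then show thesis
  proof
    assume "?dot u u > 0"
    moreover have "L u x = s * u x" if "x \<in> X" for x
    proof -
      have "L u x = L (\<lambda>x. L g x + s * g x) x" by (auto simp: L_def u_def intro!: sum.cong)
      also have "\<dots> = s * u x" using that by (simp add: Ladd Lscale LL u_def s algebra_simps mult.assoc[symmetric])
      finally show ?thesis .
    qed
    ultimately show thesis using that[of u s] s bound by (auto simp: u_def)
  next
    assume "?dot u u = 0"
    then have "L g x = - s * g x" if "x \<in> X" for x
      using zero[of u x] that by (simp add: u_def)
    then show thesis using that[of g "- s"] s bound gg by auto
  qed
qed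

section \<open>Dirichlet eigenvalues\<close>

definition dirichlet :: "(addr \<Rightarrow> real) \<Rightarrow> bool" where
  "dirichlet f \<longleftrightarrow> f Bd1 = 0 \<and> f Bd2 = 0"

definition dirichlet_spec :: "nat \<Rightarrow> real set" where
  "dirichlet_spec n = {t. \<exists>f j1 j2. dirichlet f \<and> response n t f j1 j2 \<and> ip n f f > 0}"

lemma form_sum_left: "form n t (\<lambda>x. \<Sum>y\<in>Y. c y * f y x) k = (\<Sum>y\<in>Y. c y * form n t (f y) k)"
proof (induction Y rule: infinite_finite_induct)
  case (insert y Y)
  then show ?case by (simp add: form_add_left form_scale_left)
qed (use form_scale_left[of n t 0 "\<lambda>_. 0" k] in simp_all)

lemma dirichlet_form_sum:
  assumes "dirichlet f"
  shows "form n t f k = (\<Sum>y\<in>inner_verts n. f y * form n t (\<lambda>x. of_bool (x = y)) k)"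
proof -
  have "form n t f k = form n t (\<lambda>x. \<Sum>y\<in>inner_verts n. f y * of_bool (x = y)) k"
  proof (rule form_cong)
    fix x assume "x \<in> verts (G n)"
    have "(\<Sum>y\<in>inner_verts n. f y * of_bool (x = y)) = (\<Sum>y\<in>inner_verts n. if y = x then f y else 0)"
      by (intro sum.cong) auto
    then show "f x = (\<Sum>y\<in>inner_verts n. f y * of_bool (x = y))"
      using \<open>x \<in> verts (G n)\<close> assms by (auto simp: verts_G dirichlet_def)
  qed simp
  then show ?thesis by (simp only: form_sum_left)
qed

text \<open>\<open>C\<close> bounds the squared dual norm of the residual of \<open>v\<close>. A
  small residual alone would allow \<open>s = t\<close>; orthogonality to the Dirichlet eigenspace
  of \<open>t\<close> yields a different eigenvalue.\<close>

lemma approx_dirichlet_spec: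
  assumes "dirichlet v" "ip n v v > 0"
    and ker: "\<And>h j1 j2. dirichlet h \<Longrightarrow> response n t h j1 j2 \<Longrightarrow> ip n v h = 0"
    and C: "\<And>k. dirichlet k \<Longrightarrow> (form n t v k)\<^sup>2 \<le> C * ip n k k"
  obtains s where "s \<in> dirichlet_spec n" "s \<noteq> t" "(s - t)\<^sup>2 * ip n v v \<le> C"
proof -
  let ?X = "inner_verts n"
  let ?d = "\<lambda>y x. of_bool (x = y) :: real"
  \<comment> \<open>\<open>M\<close> is the Dirichlet matrix of the Laplacian shifted by
    \<open>t\<close>: its kernel is the eigenspace of \<open>t\<close>, and an eigenvalue
    \<open>s\<close> of \<open>M\<close> becomes \<open>t + s\<close>.\<close>
  define M where "M x y = form n t (?d x) (?d y)" for x y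
  let ?L = "\<lambda>f x. \<Sum>y\<in>?X. M x y * f y"
  have dd: "dirichlet (?d y)" if "y \<in> ?X" for y using that by (auto simp: dirichlet_def)
  have L: "?L f x = form n t f (?d x)" if "dirichlet f" for f x
    by (simp add: dirichlet_form_sum[OF that] M_def form_commute[of n t "?d x"] mult.commute)
  have Lsum: "form n t f k = (\<Sum>x\<in>?X. ?L f x * k x)" if "dirichlet f" "dirichlet k" for f k
  proof -
    have "form n t f k = form n t k f" by (rule form_commute)
    also have "\<dots> = (\<Sum>x\<in>?X. k x * form n t (?d x) f)" by (rule dirichlet_form_sum[OF that(2)])
    also have "\<dots> = (\<Sum>x\<in>?X. ?L f x * k x)"
      by (intro sum.cong refl) (subst L[OF that(1)], simp add: form_commute[of n t f] mult.commute)
    finally show ?thesis .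
  qed
  have resp: "\<exists>j1 j2. response n (t + s) f j1 j2" if f: "dirichlet f" "\<And>x. x \<in> ?X \<Longrightarrow> ?L f x = s * f x" for f s
  proof -
    have "form n (t + s) f k = 0" if "k Bd1 = 0" "k Bd2 = 0" for k
    proof -
      have "form n t f k = s * ip n f k"
        using that f by (subst Lsum) (auto simp: ip_def dirichlet_def sum_distrib_left mult.assoc)
      then show ?thesis by (simp add: form_def algebra_simps)
    qed
    then show ?thesis using response_exists by metis
  qed
  obtain f s where f: "\<And>x. x \<notin> ?X \<Longrightarrow> f x = 0" "(\<Sum>x\<in>?X. f x * f x) > 0" "s \<noteq> 0"
    "s\<^sup>2 * (\<Sum>x\<in>?X. v x * v x) \<le> (\<Sum>x\<in>?X. (?L v x)\<^sup>2)" "\<And>x. x \<in> ?X \<Longrightarrow> ?L f x = s * f x"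
  proof (rule symmetric_matrix_approx_eigenvector[of ?X M v])
    show "finite ?X" by simp
    show "M x y = M y x" for x y unfolding M_def by (rule form_commute)
    show "0 < (\<Sum>x\<in>?X. v x * v x)" using assms(2) by (simp add: ip_def)
    fix h assume h: "\<forall>x\<in>?X. ?L h x = 0"
    define h' where "h' x = (if x \<in> ?X then h x else 0)" for x
    have "?L h' x = ?L h x" for x by (auto simp: h'_def intro!: sum.cong)
    moreover have h': "dirichlet h'" by (simp add: h'_def dirichlet_def)
    ultimately obtain j1 j2 where "response n t h' j1 j2" using resp[of h' 0] h by auto
    then have "ip n v h' = 0" using ker h' by blast
    then show "(\<Sum>x\<in>?X. h x * v x) = 0" by (simp add: ip_def h'_def mult.commute cong: sum.cong)
  qed blast
  have df: "dirichlet f" using f(1) by (simp add: dirichlet_def)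
  obtain j1 j2 where "response n (t + s) f j1 j2" using resp[OF df f(5)] by blast
  then have "t + s \<in> dirichlet_spec n" using df f(2) by (auto simp: dirichlet_spec_def ip_def)
  moreover have "(\<Sum>x\<in>?X. (?L v x)\<^sup>2) \<le> C"
  proof -
    \<comment> \<open>The dual norm is attained at the residual itself.\<close>
    define k where "k x = (if x \<in> ?X then ?L v x else 0)" for x
    have k: "dirichlet k" by (simp add: k_def dirichlet_def)
    define N where "N = (\<Sum>x\<in>?X. (?L v x)\<^sup>2)"
    have "form n t v k = N" unfolding Lsum[OF assms(1) k] N_def by (simp add: k_def power2_eq_square)
    moreover have "ip n k k = N" by (simp add: ip_def k_def N_def power2_eq_square)
    ultimately have "N\<^sup>2 \<le> C * N" using C[OF k] by simp
    moreover have "N \<ge> 0" unfolding N_def by (intro sum_nonneg) auto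
    moreover have "C \<ge> 0"
    proof -
      have "0 \<le> C * ip n v v" using C[OF assms(1)] by (meson order_trans zero_le_power2)
      then show ?thesis using assms(2) by (simp add: zero_le_mult_iff)
    qed
    ultimately show ?thesis unfolding N_def[symmetric]
      by (cases "N = 0") (simp_all add: power2_eq_square)
  qed
  ultimately show thesis using that[of "t + s"] f(3,4) by (auto simp: ip_def)
qed

lemma dirichlet_spec_bounds: "t \<in> dirichlet_spec n \<Longrightarrow> 0 \<le> t \<and> t \<le> 8"
proof -
  assume "t \<in> dirichlet_spec n"
  then obtain f j1 j2 where f: "dirichlet f" "response n t f j1 j2" "ip n f f > 0"
    by (auto simp: dirichlet_spec_def)
  have "energy (G n) f f = t * ip n f f"
    using responseD[OF f(2), of f] f(1) by (simp add: form_def dirichlet_def)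
  then have "0 \<le> t * ip n f f" "t * ip n f f \<le> 8 * ip n f f"
    using energy_nonneg[of "G n" f] energy_le[of n f] f(1) by (auto simp: dirichlet_def)
  then show ?thesis using f(3) by (simp add: zero_le_mult_iff)
qed

section \<open>The response of \<open>G\<^sub>n\<close>\<close>

text \<open>Away from its poles, the response of \<open>G\<^sub>n\<close> to boundary values \<open>(x, y)\<close> at the spectral
  parameter \<open>t\<close> is \<open>(p x + q y, q x + p y)\<close>; the centre vertex carries the coefficient \<open>den n t\<close>.\<close>

fun rp :: "nat \<Rightarrow> real \<Rightarrow> real" and rq :: "nat \<Rightarrow> real \<Rightarrow> real" where
  "rp 0 t = 1"
| "rq 0 t = - 1"
| "rp (Suc n) t = rp (n - 1) t - (rq (n - 1) t)\<^sup>2 / (2 * rp (n - 1) t + 2 * rp n t + 2 * rq n t - t)"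
| "rq (Suc n) t = - ((rq (n - 1) t)\<^sup>2 / (2 * rp (n - 1) t + 2 * rp n t + 2 * rq n t - t))"

declare rp.simps(2) [simp del] rq.simps(2) [simp del]

definition den :: "nat \<Rightarrow> real \<Rightarrow> real" where
  "den n t = 2 * rp (n - 1) t + 2 * rp n t + 2 * rq n t - t"

lemma rq_Suc: "rq (Suc n) t = - ((rq (n - 1) t)\<^sup>2 / den n t)"
  by (simp add: den_def rq.simps(2))

lemma rp_Suc: "rp (Suc n) t = rp (n - 1) t + rq (Suc n) t"
  by (simp add: rp.simps(2) rq.simps(2))

lemma den_0: "den 0 t = 2 - t"
  by (simp add: den_def)

text \<open>Together with \<open>rq_Suc\<close> this closes the recursion on the pair
  \<open>den\<close>, \<open>rq\<close>; the escape argument works with that pair alone.\<close>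

lemma den_Suc: "den (Suc n) t = den n t - 2 * rq n t + 4 * rq (Suc n) t"
  by (simp add: den_def rp_Suc)

lemma rq_nonzero: "(\<And>m. m < n \<Longrightarrow> den m t \<noteq> 0) \<Longrightarrow> rq n t \<noteq> 0"
proof (induction n rule: G_induct)
  case (Suc n)
  then have "rq (n - 1) t \<noteq> 0" by simp
  then show ?case using Suc.prems[of n] by (simp add: rq_Suc)
qed simp

text \<open>Schur complement: the three copies are solved with a common centre value
  \<open>?z\<close>, and the flux balance at the centre fixes it because its coefficient
  \<open>den n t\<close> is nonzero.\<close>

lemma boundary_value_problem:
  assumes "\<And>m. m < n \<Longrightarrow> den m t \<noteq> 0"
  obtains f where "f Bd1 = x" "f Bd2 = y"
    "response n t f (rp n t * x + rq n t * y) (rq n t * x + rp n t * y)"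
proof -
  have "\<exists>f. f Bd1 = x \<and> f Bd2 = y \<and>
    response n t f (rp n t * x + rq n t * y) (rq n t * x + rp n t * y)"
    using assms
  proof (induction n arbitrary: x y rule: G_induct)
    case 0
    show ?case
      by (rule exI[of _ "\<lambda>v. if v = Bd1 then x else y"])
        (simp add: response_def form_0 algebra_simps)
  next
    case (Suc n)
    let ?z = "- rq (n - 1) t * (x + y) / den n t"
    have d: "den n t \<noteq> 0" using Suc.prems by simp
    have IH: "\<exists>f. f Bd1 = x \<and> f Bd2 = y \<and> response (n - 1) t f
        (rp (n - 1) t * x + rq (n - 1) t * y) (rq (n - 1) t * x + rp (n - 1) t * y)" for x y
      using Suc.IH(2) Suc.prems by simp
    obtain f1 where f1: "f1 Bd1 = x" "f1 Bd2 = ?z" "response (n - 1) t f1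
        (rp (n - 1) t * x + rq (n - 1) t * ?z) (rq (n - 1) t * x + rp (n - 1) t * ?z)"
      using IH[of x ?z] by blast
    obtain f2 where f2: "f2 Bd1 = ?z" "f2 Bd2 = y" "response (n - 1) t f2
        (rp (n - 1) t * ?z + rq (n - 1) t * y) (rq (n - 1) t * ?z + rp (n - 1) t * y)"
      using IH[of ?z y] by blast
    have "\<exists>f. f Bd1 = ?z \<and> f Bd2 = ?z \<and> response n t f
        (rp n t * ?z + rq n t * ?z) (rq n t * ?z + rp n t * ?z)"
      by (rule Suc.IH(1)) (use Suc.prems in simp)
    then obtain f3 where f3: "f3 Bd1 = ?z" "f3 Bd2 = ?z" "response n t f3
        (rp n t * ?z + rq n t * ?z) (rq n t * ?z + rp n t * ?z)" by blast
    have z: "den n t * ?z = - rq (n - 1) t * (x + y)" using d by simp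
    let ?f = "join f1 f2 f3"
    have "response (Suc n) t ?f (rp (n - 1) t * x + rq (n - 1) t * ?z) (rq (n - 1) t * ?z + rp (n - 1) t * y)"
    proof (rule response_join[OF f1(3) f2(3) f3(3) f1(2) f2(1) f3(1,2)])
      show "rp n t * ?z + rq n t * ?z + (rq n t * ?z + rp n t * ?z) +
          (rq (n - 1) t * x + rp (n - 1) t * ?z) + (rp (n - 1) t * ?z + rq (n - 1) t * y) = t * ?z"
        using z unfolding den_def by algebra
    qed
    moreover have "rq (n - 1) t * ?z = rq (Suc n) t * (x + y)"
      by (simp add: rq_Suc power2_eq_square)
    then have "rp (n - 1) t * x + rq (n - 1) t * ?z = rp (Suc n) t * x + rq (Suc n) t * y"
      "rq (n - 1) t * ?z + rp (n - 1) t * y = rq (Suc n) t * x + rp (Suc n) t * y"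
      by (simp_all only: rp_Suc) (simp_all add: algebra_simps)
    ultimately show ?case using f1 f2 by (intro exI[of _ ?f]) (simp only: join.simps)
  qed
  then show thesis using that by blast
qed

text \<open>Green's identity against the solutions with unit boundary values determines the
  fluxes.\<close>

lemma response_flux:
  assumes "\<And>m. m < n \<Longrightarrow> den m t \<noteq> 0" "response n t f j1 j2"
  shows "j1 = rp n t * f Bd1 + rq n t * f Bd2" "j2 = rq n t * f Bd1 + rp n t * f Bd2"
proof -
  obtain g where "g Bd1 = 1" "g Bd2 = 0" "response n t g (rp n t) (rq n t)"
    using boundary_value_problem[OF assms(1), of n 1 0] by auto
  then show "j1 = rp n t * f Bd1 + rq n t * f Bd2" using response_Green[OF assms(2)] by fastforce
  obtain h where "h Bd1 = 0" "h Bd2 = 1" "response n t h (rq n t) (rp n t)"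
    using boundary_value_problem[OF assms(1), of n 0 1] by auto
  then show "j2 = rq n t * f Bd1 + rp n t * f Bd2" using response_Green[OF assms(2)] by fastforce
qed

text \<open>With zero outer values the balance at the centre reads
  \<open>den n t * f Ctr = 0\<close>, so \<open>f\<close> is again Dirichlet on every copy.\<close>

lemma dirichlet_unique:
  assumes "\<And>m. m < n \<Longrightarrow> den m t \<noteq> 0" "dirichlet f" "response n t f j1 j2"
  shows "ip n f f = 0"
  using assms
proof (induction n arbitrary: f j1 j2 rule: G_induct)
  case 0
  then show ?case by (simp add: ip_def)
next
  case (Suc n)
  obtain b c l1 l2 where s: "response (n - 1) t (on1 f) j1 b" "response (n - 1) t (on2 f) c j2"
    "response n t (on3 f) l1 l2" "l1 + l2 + b + c = t * f Ctr"
    using response_split[OF Suc.prems(3)] .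
  have lt: "den m t \<noteq> 0" if "m < n - 1 \<or> m < n" for m using that Suc.prems(1) by auto
  have "f Bd1 = 0" "f Bd2 = 0" using Suc.prems(2) by (auto simp: dirichlet_def)
  then have "den n t * f Ctr = 0"
    using response_flux[OF lt s(1)] response_flux[OF lt s(2)] response_flux[OF lt s(3)] s(4)
    by (simp add: den_def algebra_simps)
  then have "f Ctr = 0" using Suc.prems(1) by simp
  then have "dirichlet (on1 f)" "dirichlet (on2 f)" "dirichlet (on3 f)"
    using Suc.prems(2) by (auto simp: dirichlet_def)
  then show ?case
    using Suc.IH(1)[OF lt _ s(3)] Suc.IH(2)[OF lt _ s(1)] Suc.IH(2)[OF lt _ s(2)] \<open>f Ctr = 0\<close>
    by (simp add: ip_Suc)
qed

lemma dirichlet_specE: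
  assumes "t \<in> dirichlet_spec n"
  obtains k where "k < n" "den k t = 0" "\<And>m. m < k \<Longrightarrow> den m t \<noteq> 0"
proof -
  obtain k where "k < n" "den k t = 0"
    using assms dirichlet_unique[of n t] by (force simp: dirichlet_spec_def)
  then have "(LEAST k. den k t = 0) < n" "den (LEAST k. den k t = 0) t = 0"
    by (meson Least_le order_le_less_trans LeastI)+
  then show thesis using that not_less_Least by blast
qed

section \<open>Eigenfunctions at a first zero of the denominators\<close>

locale first_zero =
  fixes k :: nat and t :: real
  assumes den_zero: "den k t = 0" and den_nonzero: "\<And>m. m < k \<Longrightarrow> den m t \<noteq> 0"
begin

abbreviation \<beta> :: real where "\<beta> \<equiv> rq (k - 1) t"

lemma beta_nonzero: "\<beta> \<noteq> 0"
  by (rule rq_nonzero) (use den_nonzero in auto)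

lemma den_nonzero': "m < k - 1 \<Longrightarrow> den m t \<noteq> 0"
  using den_nonzero by simp

text \<open>With centre value 1 on all three copies, the balance at the centre is just
  \<open>den k t = 0\<close>. By \<open>dirichlet_unique\<close> no lower level has a Dirichlet
  eigenfunction for \<open>t\<close>.\<close>

lemma ground_state:
  obtains \<phi> where "dirichlet \<phi>" "response (Suc k) t \<phi> \<beta> \<beta>" "\<phi> Ctr = 1"
proof -
  obtain f1 where f1: "f1 Bd1 = 0" "f1 Bd2 = 1" "response (k - 1) t f1 \<beta> (rp (k - 1) t)"
    using boundary_value_problem[OF den_nonzero', of "k - 1" 0 1] by auto
  obtain f2 where f2: "f2 Bd1 = 1" "f2 Bd2 = 0" "response (k - 1) t f2 (rp (k - 1) t) \<beta>"
    using boundary_value_problem[OF den_nonzero', of "k - 1" 1 0] by auto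
  obtain f3 where f3: "f3 Bd1 = 1" "f3 Bd2 = 1" "response k t f3 (rp k t + rq k t) (rq k t + rp k t)"
    using boundary_value_problem[OF den_nonzero, of k 1 1] by auto
  have "response (Suc k) t (join f1 f2 f3) \<beta> \<beta>"
    using den_zero
    by (intro response_join[OF f1(3) f2(3) f3(3) f1(2) f2(1) f3(1,2)]) (simp add: den_def)
  then show thesis using that[of "join f1 f2 f3"] f1 f2 by (simp add: dirichlet_def)
qed

text \<open>Subtracting \<open>h Ctr * \<phi> x\<close> makes the centre value zero, and uniqueness
  on the three smaller copies applies: the eigenspace is one-dimensional. It is parametrised by the
  flux \<open>i2\<close>, the quantity that can be followed through gluing.\<close>

lemma dirichlet_eigenfunction:
  assumes \<phi>: "dirichlet \<phi>" "response (Suc k) t \<phi> \<beta> \<beta>" "\<phi> Ctr = 1"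
    and h: "dirichlet h" "response (Suc k) t h i1 i2"
  shows "i1 = i2" "ip (Suc k) \<phi> h * \<beta> = ip (Suc k) \<phi> \<phi> * i2"
proof -
  obtain b c l1 l2 where s: "response (k - 1) t (on1 h) i1 b" "response (k - 1) t (on2 h) c i2"
    "response k t (on3 h) l1 l2" "l1 + l2 + b + c = t * h Ctr" using response_split[OF h(2)] .
  have i: "i1 = \<beta> * h Ctr" "i2 = \<beta> * h Ctr"
    using response_flux[OF den_nonzero' s(1)] response_flux[OF den_nonzero' s(2)] h(1)
    by (simp_all add: dirichlet_def)
  then show "i1 = i2" by simp
  let ?f = "\<lambda>x. h x + (- h Ctr) * \<phi> x"
  obtain j1 j2 where "response (Suc k) t ?f j1 j2"
    using response_add[OF h(2) response_scale[OF \<phi>(2)]] by blast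
  from response_split[OF this] obtain b c l1 l2
    where s: "response (k - 1) t (on1 ?f) j1 b" "response (k - 1) t (on2 ?f) c j2"
      "response k t (on3 ?f) l1 l2" "l1 + l2 + b + c = t * ?f Ctr" .
  have "?f Ctr = 0" "?f Bd1 = 0" "?f Bd2 = 0" using \<phi> h by (auto simp: dirichlet_def)
  then have "dirichlet (on1 ?f)" "dirichlet (on2 ?f)" "dirichlet (on3 ?f)"
    by (simp_all add: dirichlet_def)
  then have "ip (Suc k) ?f ?f = 0"
    unfolding ip_Suc \<open>?f Ctr = 0\<close>
    using dirichlet_unique[OF den_nonzero' _ s(1)] dirichlet_unique[OF den_nonzero' _ s(2)]
      dirichlet_unique[OF den_nonzero _ s(3)] by simp
  then have "ip (Suc k) ?f \<phi> = 0" by (rule ip_zeroD)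
  then have "ip (Suc k) h \<phi> = h Ctr * ip (Suc k) \<phi> \<phi>"
    unfolding ip_add_left ip_scale_left by simp
  then show "ip (Suc k) \<phi> h * \<beta> = ip (Suc k) \<phi> \<phi> * i2"
    using i by (simp add: ip_commute[of _ \<phi> h])
qed

text \<open>The middle copy of \<open>G (Suc (Suc k))\<close> is \<open>G (Suc k)\<close>; a
  multiple of its ground state absorbs the flux arriving at the centre while the centre value stays
  0, so the other side can vanish identically. Two levels up, the solution sits on one side
  copy.\<close>

lemma one_sided_solution:
  shows "\<exists>w i. response (Suc (Suc k) + 2 * j) t w i 0 \<and> w Bd1 = 1 \<and> w Bd2 = 0"
    and "\<exists>w i. response (Suc (Suc k) + 2 * j) t w 0 i \<and> w Bd1 = 0 \<and> w Bd2 = 1"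
proof (induction j)
  case 0
  obtain \<phi> where \<phi>: "dirichlet \<phi>" "response (Suc k) t \<phi> \<beta> \<beta>" using ground_state by metis
  \<comment> \<open>Both ends of the ground state feed \<open>?c * \<beta>\<close> into the centre,
    which cancels the flux \<open>rq k t\<close> of the side solution.\<close>
  let ?c = "- rq k t / (2 * \<beta>)"
  let ?f3 = "\<lambda>x. ?c * \<phi> x"
  have c: "?c * \<beta> + ?c * \<beta> + rq k t = 0" using beta_nonzero by (simp add: field_simps)
  have 3: "response (Suc k) t ?f3 (?c * \<beta>) (?c * \<beta>)" by (rule response_scale[OF \<phi>(2)])
  have z: "?f3 Bd1 = 0" "?f3 Bd2 = 0" using \<phi> by (simp_all add: dirichlet_def)
  {
    case 1
    obtain y where y: "y Bd1 = 1" "y Bd2 = 0" "response k t y (rp k t) (rq k t)"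
      using boundary_value_problem[OF den_nonzero, of k 1 0] by auto
    let ?w = "join y (\<lambda>_. 0) ?f3"
    have "response (Suc (Suc k)) t ?w (rp k t) 0"
      using z c by (intro response_join_Suc[OF y(3) response_zero 3 y(2)]) simp_all
    then show ?case using y by (intro exI[of _ ?w] exI) auto
  next
    case 2
    obtain y where y: "y Bd1 = 0" "y Bd2 = 1" "response k t y (rq k t) (rp k t)"
      using boundary_value_problem[OF den_nonzero, of k 0 1] by auto
    let ?w = "join (\<lambda>_. 0) y ?f3"
    have "response (Suc (Suc k)) t ?w 0 (rp k t)"
      using z c y(1) by (intro response_join_Suc[OF response_zero y(3) 3, where z = 0]) simp_all
    then show ?case using y by (intro exI[of _ ?w] exI) auto
  }
next
  case (Suc j)
  {
    case 1
    obtain w i where w: "response (Suc (Suc k) + 2 * j) t w i 0" "w Bd1 = 1" "w Bd2 = 0"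
      using Suc by blast
    have "response (Suc (Suc (Suc (Suc k) + 2 * j))) t (join w (\<lambda>_. 0) (\<lambda>_. 0)) i 0"
      using w by (intro response_join_Suc[OF w(1) response_zero response_zero w(3)]) simp_all
    then show ?case using w by (intro exI[of _ "join w (\<lambda>_. 0) (\<lambda>_. 0)"] exI) auto
  next
    case 2
    obtain w i where w: "response (Suc (Suc k) + 2 * j) t w 0 i" "w Bd1 = 0" "w Bd2 = 1"
      using Suc by blast
    have "response (Suc (Suc (Suc (Suc k) + 2 * j))) t (join (\<lambda>_. 0) w (\<lambda>_. 0)) 0 i"
      using w by (intro response_join_Suc[OF response_zero w(1) response_zero, where z = 0]) simp_all
    then show ?case using w by (intro exI[of _ "join (\<lambda>_. 0) w (\<lambda>_. 0)"] exI) auto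
  }
qed

text \<open>Green's identity against a solution with value 1 at one end and neither value nor flux
  at the other.\<close>

lemma odd_level_no_flux:
  assumes "dirichlet h" "response (Suc (Suc k) + 2 * j) t h l1 l2"
  shows "l1 = 0" "l2 = 0"
proof -
  obtain w i where "response (Suc (Suc k) + 2 * j) t w i 0" "w Bd1 = 1" "w Bd2 = 0"
    using one_sided_solution by blast
  then show "l1 = 0" using response_Green[OF assms(2)] assms(1) by (fastforce simp: dirichlet_def)
  obtain w i where "response (Suc (Suc k) + 2 * j) t w 0 i" "w Bd1 = 0" "w Bd2 = 1"
    using one_sided_solution by blast
  then show "l2 = 0" using response_Green[OF assms(2)] assms(1) by (fastforce simp: dirichlet_def)
qed

text \<open>The eigenfunction \<open>g\<close> is supported on a chain of \<open>2\<^sup>j\<close> copies of \<open>G\<^bsub>k+1\<^esub>\<close>, on which it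
  equals the ground state up to alternating signs.\<close>

definition chain :: "nat \<Rightarrow> real \<Rightarrow> real \<Rightarrow> real \<Rightarrow> real \<Rightarrow> (addr \<Rightarrow> real) \<Rightarrow> bool" where
  "chain n \<sigma> b \<omega> N g \<longleftrightarrow> dirichlet g \<and> response n t g (\<sigma> * b) b \<and> \<sigma>\<^sup>2 = 1 \<and> b\<^sup>2 = \<beta>\<^sup>2 \<and> ip n g g = N \<and>
    (\<forall>h i1 i2. dirichlet h \<longrightarrow> response n t h i1 i2 \<longrightarrow> i1 = \<sigma> * i2 \<and> ip n g h = \<omega> * i2)"

text \<open>Green's identity with \<open>g\<close> gives \<open>b * h Ctr = 0\<close>, so
  \<open>h\<close> is Dirichlet on all three copies. The middle copy lies one level above the chain,
  where there is no flux, so the inner fluxes of the side copies must cancel.\<close>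

lemma chain_split:
  assumes g: "chain (Suc k + 2 * j) \<sigma> b \<omega> N g"
    and h: "dirichlet h" "response (Suc (Suc (Suc k + 2 * j))) t h i1 i2"
  obtains d e where "i1 = \<sigma> * d" "ip (Suc k + 2 * j) g (on1 h) = \<omega> * d"
    "e = \<sigma> * i2" "ip (Suc k + 2 * j) g (on2 h) = \<omega> * i2" "d + e = 0"
proof -
  obtain d e l1 l2 where s: "response (Suc k + 2 * j) t (on1 h) i1 d"
    "response (Suc k + 2 * j) t (on2 h) e i2" "response (Suc (Suc k + 2 * j)) t (on3 h) l1 l2"
    and bal: "l1 + l2 + d + e = t * h Ctr"
    using response_split[OF h(2), unfolded diff_Suc_1] .
  have g': "dirichlet g" "response (Suc k + 2 * j) t g (\<sigma> * b) b" "b\<^sup>2 = \<beta>\<^sup>2" using g by (auto simp: chain_def)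
  have "b * h Ctr = 0"
    using response_Green[OF s(1) g'(2)] g'(1) h(1) by (simp add: dirichlet_def)
  moreover have "b \<noteq> 0" using g'(3) beta_nonzero by auto
  ultimately have "h Ctr = 0" by simp
  then have dir: "dirichlet (on1 h)" "dirichlet (on2 h)" "dirichlet (on3 h)"
    using h(1) by (auto simp: dirichlet_def)
  have "l1 = 0" "l2 = 0"
    using odd_level_no_flux[of "on3 h" j l1 l2] dir(3) s(3) by auto
  then have "d + e = 0" using bal \<open>h Ctr = 0\<close> by simp
  moreover have "i1 = \<sigma> * d" "ip (Suc k + 2 * j) g (on1 h) = \<omega> * d"
    using g dir(1) s(1) by (auto simp: chain_def)
  moreover have "e = \<sigma> * i2" "ip (Suc k + 2 * j) g (on2 h) = \<omega> * i2"
    using g dir(2) s(2) by (auto simp: chain_def)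
  ultimately show thesis using that by blast
qed

text \<open>Placing a chain in both side copies doubles the squared norm and keeps the end flux at
  absolute value \<open>\<bar>\<beta>\<bar>\<close>. The last clause of \<open>chain\<close> carries
  through the induction that eigenfunctions pair with the chain only through the single number
  \<open>i2\<close>.\<close>

lemma chain_exists:
  obtains N where "N > 0" "\<And>j. \<exists>\<sigma> b \<omega> g. chain (Suc k + 2 * j) \<sigma> b \<omega> (2 ^ j * N) g"
proof -
  obtain \<phi> where \<phi>: "dirichlet \<phi>" "response (Suc k) t \<phi> \<beta> \<beta>" "\<phi> Ctr = 1" using ground_state .
  let ?N = "ip (Suc k) \<phi> \<phi>"
  have "\<exists>\<sigma> b \<omega> g. chain (Suc k + 2 * j) \<sigma> b \<omega> (2 ^ j * ?N) g" for j
  proof (induction j)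
    case 0
    have "chain (Suc k) 1 \<beta> (?N / \<beta>) ?N \<phi>"
      unfolding chain_def
    proof (intro conjI allI impI)
      fix h i1 i2 assume h: "dirichlet h" "response (Suc k) t h i1 i2"
      show "i1 = 1 * i2" "ip (Suc k) \<phi> h = ?N / \<beta> * i2"
        using dirichlet_eigenfunction[OF \<phi> h] beta_nonzero by (simp_all add: field_simps)
    qed (use \<phi> in auto)
    then show ?case by auto
  next
    case (Suc j)
    then obtain \<sigma> b \<omega> g where g: "chain (Suc k + 2 * j) \<sigma> b \<omega> (2 ^ j * ?N) g" by blast
    let ?n = "Suc k + 2 * j"
    \<comment> \<open>The factor makes the fluxes \<open>b\<close> and
      \<open>- \<sigma> * (\<sigma> * b)\<close> cancel at the centre.\<close>
    let ?g2 = "\<lambda>x. - \<sigma> * g x"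
    let ?g = "join g ?g2 (\<lambda>_. 0)"
    have g': "dirichlet g" "response ?n t g (\<sigma> * b) b" "\<sigma>\<^sup>2 = 1" "b\<^sup>2 = \<beta>\<^sup>2" "ip ?n g g = 2 ^ j * ?N"
      using g by (auto simp: chain_def)
    have s1: "\<sigma> * (\<sigma> * x) = x" for x using g'(3) by (simp add: power2_eq_square mult.assoc[symmetric])
    have z: "g Bd1 = 0" "g Bd2 = 0" using g'(1) by (simp_all add: dirichlet_def)
    have on: "on1 ?g = g" "on2 ?g = ?g2" "on3 ?g = (\<lambda>_. 0)" using z by simp_all
    have "chain (Suc (Suc ?n)) (- 1) (- \<sigma> * b) (- 2 * \<sigma> * \<omega>) (2 ^ Suc j * ?N) ?g"
      unfolding chain_def
    proof (intro conjI allI impI)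
      show "dirichlet ?g" using z by (simp add: dirichlet_def)
      have "response ?n t ?g2 (- \<sigma> * (\<sigma> * b)) (- \<sigma> * b)" by (rule response_scale[OF g'(2)])
      then show "response (Suc (Suc ?n)) t ?g (- 1 * (- \<sigma> * b)) (- \<sigma> * b)"
        using response_join_Suc[OF g'(2) _ response_zero z(2)] z s1 by simp
      show "(- 1)\<^sup>2 = (1::real)" by simp
      show "(- \<sigma> * b)\<^sup>2 = \<beta>\<^sup>2" using g'(3,4) by (simp add: power_mult_distrib)
      have ipg: "ip (Suc (Suc ?n)) ?g h = ip ?n g (on1 h) + - \<sigma> * ip ?n g (on2 h)" for h
        unfolding ip_Suc[of "Suc ?n"] on diff_Suc_1 ip_scale_left[of _ "- \<sigma>"] using z by (simp add: ip_def)
      show "ip (Suc (Suc ?n)) ?g ?g = 2 ^ Suc j * ?N"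
        unfolding ipg on by (subst ip_commute, subst ip_scale_left) (simp add: g'(5)[simplified] s1)
      fix h i1 i2 assume h: "dirichlet h" "response (Suc (Suc ?n)) t h i1 i2"
      obtain d e where de: "i1 = \<sigma> * d" "ip ?n g (on1 h) = \<omega> * d" "e = \<sigma> * i2" "ip ?n g (on2 h) = \<omega> * i2" "d + e = 0"
        using chain_split[OF g h] .
      have d: "d = - \<sigma> * i2" using de by simp
      show "i1 = - 1 * i2" using de(1) d s1 by simp
      show "ip (Suc (Suc ?n)) ?g h = - 2 * \<sigma> * \<omega> * i2"
        unfolding ipg de(2,4) d by (simp add: algebra_simps)
    qed
    then show ?case by (auto simp del: power_Suc)
  qed
  moreover have "?N > 0" using \<phi>(3) by (simp add: ip_Suc add_pos_nonneg ip_nonneg)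
  ultimately show thesis using that by blast
qed

text \<open>Gluing two chains with the wrong sign gives a function orthogonal to all eigenfunctions
  that violates the eigenvalue equation at a single vertex only.\<close>

lemma nearby_eigenvalue:
  assumes "\<epsilon> > 0"
  obtains n s where "s \<in> dirichlet_spec n" "s \<noteq> t" "\<bar>s - t\<bar> < \<epsilon>"
proof -
  obtain N where N: "N > 0" "\<And>j. \<exists>\<sigma> b \<omega> g. chain (Suc k + 2 * j) \<sigma> b \<omega> (2 ^ j * N) g"
    using chain_exists by blast
  \<comment> \<open>The residual below sits at one vertex and has square
    \<open>4 * \<beta>\<^sup>2\<close>, whereas the squared norm grows like
    \<open>2 ^ j * N\<close>.\<close>
  obtain j where j: "4 * \<beta>\<^sup>2 / (\<epsilon>\<^sup>2 * N) < 2 ^ j" using real_arch_pow[of 2] by auto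
  obtain \<sigma> b \<omega> g where g: "chain (Suc k + 2 * j) \<sigma> b \<omega> (2 ^ j * N) g" using N by blast
  let ?n = "Suc k + 2 * j"
  \<comment> \<open>With \<open>\<sigma>\<close> in place of \<open>- \<sigma>\<close> the fluxes at
    the centre add up to \<open>2 * b\<close>, while the pairings of any eigenfunction with the two
    halves cancel.\<close>
  let ?g2 = "\<lambda>x. \<sigma> * g x"
  let ?v = "join g ?g2 (\<lambda>_. 0)"
  have g': "dirichlet g" "response ?n t g (\<sigma> * b) b" "\<sigma>\<^sup>2 = 1" "b\<^sup>2 = \<beta>\<^sup>2" "ip ?n g g = 2 ^ j * N"
    using g by (auto simp: chain_def)
  have s1: "\<sigma> * (\<sigma> * x) = x" for x using g'(3) by (simp add: power2_eq_square mult.assoc[symmetric])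
  have z: "g Bd1 = 0" "g Bd2 = 0" using g'(1) by (simp_all add: dirichlet_def)
  have on: "on1 ?v = g" "on2 ?v = ?g2" "on3 ?v = (\<lambda>_. 0)" using z by simp_all
  have ipv: "ip (Suc (Suc ?n)) ?v h = ip ?n g (on1 h) + \<sigma> * ip ?n g (on2 h)" for h
    unfolding ip_Suc[of "Suc ?n"] on diff_Suc_1 ip_scale_left[of _ \<sigma>] using z by (simp add: ip_def)
  have vv: "ip (Suc (Suc ?n)) ?v ?v = 2 ^ Suc j * N"
    unfolding ipv on by (subst ip_commute, subst ip_scale_left) (simp add: g'(5)[simplified] s1)
  have dv: "dirichlet ?v" using z by (simp add: dirichlet_def)
  obtain s where s: "s \<in> dirichlet_spec (Suc (Suc ?n))" "s \<noteq> t"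
    "(s - t)\<^sup>2 * ip (Suc (Suc ?n)) ?v ?v \<le> 4 * \<beta>\<^sup>2"
  proof (rule approx_dirichlet_spec[OF dv])
    show "0 < ip (Suc (Suc ?n)) ?v ?v" using vv N(1) by simp
  next
    fix h j1 j2 assume h: "dirichlet h" "response (Suc (Suc ?n)) t h j1 j2"
    obtain d e where de: "j1 = \<sigma> * d" "ip ?n g (on1 h) = \<omega> * d" "e = \<sigma> * j2" "ip ?n g (on2 h) = \<omega> * j2" "d + e = 0"
      using chain_split[OF g h] .
    have d: "d = - \<sigma> * j2" using de by simp
    show "ip (Suc (Suc ?n)) ?v h = 0" unfolding ipv de(2,4) d by (simp add: algebra_simps)
  next
    fix h assume h: "dirichlet h"
    have "form (Suc (Suc ?n)) t ?v h = form ?n t g (on1 h) + \<sigma> * form ?n t g (on2 h)"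
      unfolding form_Suc[of "Suc ?n"] on diff_Suc_1 form_scale_left[of _ _ \<sigma>]
      using z by (simp add: form_commute[of _ _ "\<lambda>_. 0"])
    also have "\<dots> = 2 * b * h Ctr"
      unfolding responseD[OF g'(2)] using h by (simp add: dirichlet_def s1 algebra_simps)
    finally have "(form (Suc (Suc ?n)) t ?v h)\<^sup>2 = 4 * \<beta>\<^sup>2 * (h Ctr)\<^sup>2"
      using g'(4) by (simp add: power_mult_distrib)
    also have "\<dots> \<le> 4 * \<beta>\<^sup>2 * ip (Suc (Suc ?n)) h h"
    proof (intro mult_left_mono)
      show "(h Ctr)\<^sup>2 \<le> ip (Suc (Suc ?n)) h h"
        unfolding ip_Suc[of "Suc ?n"] by (simp add: power2_eq_square ip_nonneg add_nonneg_nonneg)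
    qed simp
    finally show "(form (Suc (Suc ?n)) t ?v h)\<^sup>2 \<le> 4 * \<beta>\<^sup>2 * ip (Suc (Suc ?n)) h h" .
  qed blast
  have "(s - t)\<^sup>2 * (2 ^ j * N) \<le> 4 * \<beta>\<^sup>2"
  proof -
    have "(s - t)\<^sup>2 * (2 ^ j * N) \<le> (s - t)\<^sup>2 * (2 ^ Suc j * N)"
      using N(1) by (intro mult_left_mono) auto
    also have "\<dots> \<le> 4 * \<beta>\<^sup>2" using s(3) unfolding vv .
    finally show ?thesis .
  qed
  also have "4 * \<beta>\<^sup>2 < \<epsilon>\<^sup>2 * (2 ^ j * N)" using j N(1) assms by (simp add: field_simps)
  finally have "(s - t)\<^sup>2 < \<epsilon>\<^sup>2" using N(1) by simp
  then have "\<bar>s - t\<bar> < \<epsilon>" using assms power2_less_imp_less[of "\<bar>s - t\<bar>" \<epsilon>] by simp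
  then show thesis using that s by blast
qed

text \<open>Two opposite ground states side by side have fluxes \<open>\<beta>\<close> and
  \<open>- \<beta>\<close> at their outer ends. As the middle copy of the next level these ends are
  identified and the fluxes cancel; hence level \<open>k + 4\<close>.\<close>

lemma localized_eigenfunction:
  obtains h where "dirichlet h" "response (k + 4) t h 0 0" "ip (k + 4) h h > 0"
proof -
  obtain \<phi> where \<phi>: "dirichlet \<phi>" "response (Suc k) t \<phi> \<beta> \<beta>" "\<phi> Ctr = 1" using ground_state .
  have z: "\<phi> Bd1 = 0" "\<phi> Bd2 = 0" using \<phi> by (simp_all add: dirichlet_def)
  let ?m = "\<lambda>x. - 1 * \<phi> x"
  define \<psi> where "\<psi> = join \<phi> ?m (\<lambda>_. 0)"
  have on: "on1 \<psi> = \<phi>" "on2 \<psi> = ?m" "on3 \<psi> = (\<lambda>_. 0)" "\<psi> Ctr = 0" "\<psi> Bd1 = 0" "\<psi> Bd2 = 0"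
    using z by (simp_all add: \<psi>_def)
  have "response (Suc (Suc (Suc k))) t \<psi> \<beta> (- 1 * \<beta>)"
    unfolding \<psi>_def using z
    by (intro response_join_Suc[OF \<phi>(2) response_scale[OF \<phi>(2)] response_zero z(2)]) simp_all
  moreover have "ip (Suc (Suc (Suc k))) \<psi> \<psi> > 0"
  proof -
    have "ip (Suc k) \<phi> \<phi> > 0" using \<phi>(3) by (simp add: ip_Suc add_pos_nonneg ip_nonneg)
    then show ?thesis unfolding ip_Suc[of "Suc (Suc k)"] on diff_Suc_1
      by (simp add: add_pos_nonneg add_nonneg_pos ip_nonneg)
  qed
  moreover define h where "h = join (\<lambda>_. 0) (\<lambda>_. 0) \<psi>"
  moreover have onh: "on1 h = (\<lambda>_. 0)" "on2 h = (\<lambda>_. 0)" "on3 h = \<psi>" "h Ctr = 0" "h Bd1 = 0" "h Bd2 = 0"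
    using on by (simp_all add: h_def)
  ultimately have "response (Suc (Suc (Suc (Suc k)))) t h 0 0" "ip (Suc (Suc (Suc (Suc k)))) h h > 0"
  proof -
    assume \<psi>: "response (Suc (Suc (Suc k))) t \<psi> \<beta> (- 1 * \<beta>)" "0 < ip (Suc (Suc (Suc k))) \<psi> \<psi>"
    show "response (Suc (Suc (Suc (Suc k)))) t h 0 0"
      unfolding h_def using on by (intro response_join_Suc[OF response_zero response_zero \<psi>(1), where z = 0]) simp_all
    show "ip (Suc (Suc (Suc (Suc k)))) h h > 0"
      unfolding ip_Suc[of "Suc (Suc (Suc k))"] onh diff_Suc_1
      using \<psi>(2) by (simp add: add_pos_nonneg add_nonneg_pos ip_nonneg)
  qed
  then show thesis using that[of h] onh by (simp add: dirichlet_def numeral_eq_Suc)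
qed

end

section \<open>Gaps\<close>

text \<open>The condition reproduces itself after two steps: in the letters introduced below,
  \<open>b\<close> is at most \<open>w / 16\<close>, and \<open>D\<close> two steps later is at
  least \<open>w - 2 * b\<close>, well above \<open>4 * b\<close>. In between, \<open>D\<close> is
  only shown to stay positive.\<close>

lemma escape_region:
  fixes D Q :: "nat \<Rightarrow> real"
  assumes Q: "\<And>n. Q (Suc n) = - ((Q (n - 1))\<^sup>2 / D n)"
    and D: "\<And>n. D (Suc n) = D n - 2 * Q n + 4 * Q (Suc n)"
    and m: "D m > 0" "Q m \<le> 0" "4 * \<bar>Q (m - 1)\<bar> \<le> D m"
    and "n \<ge> m"
  shows "D n > 0"
proof -
  have step: "D (Suc m) > 0 \<and> D (Suc (Suc m)) > 0 \<and> Q (Suc (Suc m)) \<le> 0 \<and> 4 * \<bar>Q (Suc m)\<bar> \<le> D (Suc (Suc m))"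
    if m: "D m > 0" "Q m \<le> 0" "4 * \<bar>Q (m - 1)\<bar> \<le> D m" for m
  proof -
    define w a b U where "w = D m" and "a = - Q m" and "b = - Q (Suc m)" and "U = D (Suc m)"
    have w: "w > 0" and a: "a \<ge> 0" using m by (simp_all add: w_def a_def)
    have "(4 * \<bar>Q (m - 1)\<bar>)\<^sup>2 \<le> w\<^sup>2" using m by (intro power_mono) (auto simp: w_def)
    then have "16 * (Q (m - 1))\<^sup>2 \<le> w * w" by (simp add: power2_eq_square)
    then have b: "0 \<le> b" "16 * b \<le> w"
      using w by (simp_all add: b_def Q w_def[symmetric] field_simps power2_eq_square)
    have U: "U = w + 2 * a - 4 * b" by (simp add: U_def D w_def a_def b_def)
    then have Upos: "U > 0" using w a b by simp
    have Q2: "Q (Suc (Suc m)) = - (a\<^sup>2 / U)" by (simp add: Q[of "Suc m"] a_def U_def)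
    have "2 * a \<le> U" using U b w by simp
    then have "2 * a * (2 * a) \<le> U * (2 * a)" using a by (intro mult_right_mono) auto
    then have "4 * (a\<^sup>2 / U) \<le> 2 * a" using Upos by (simp add: field_simps power2_eq_square)
    moreover have "D (Suc (Suc m)) = U + 2 * b - 4 * (a\<^sup>2 / U)"
      by (simp add: D[of "Suc m"] Q2 U_def b_def)
    ultimately have "D (Suc (Suc m)) \<ge> w - 2 * b" using U by simp
    moreover have "Q (Suc (Suc m)) \<le> 0" using Q2 Upos by simp
    moreover have "\<bar>Q (Suc m)\<bar> = b" using b(1) by (simp add: b_def)
    ultimately show ?thesis using Upos w b by (simp add: U_def)
  qed
  have inv: "D (m + 2 * i) > 0 \<and> Q (m + 2 * i) \<le> 0 \<and> 4 * \<bar>Q (m + 2 * i - 1)\<bar> \<le> D (m + 2 * i)" for i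
  proof (induction i)
    case (Suc i)
    then show ?case using step[of "m + 2 * i"] by simp
  qed (use m in auto)
  obtain i where "n = m + 2 * i \<or> n = Suc (m + 2 * i)"
    using \<open>n \<ge> m\<close> by (metis add.commute add_Suc_right le_add_diff_inverse odd_two_times_div_two_succ dvd_mult_div_cancel add_Suc plus_1_eq_Suc)
  then show ?thesis using inv[of i] step[of "m + 2 * i"] by auto
qed

text \<open>The recursion is odd in the pair \<open>den\<close>, \<open>rq\<close>, so both signs
  reduce to one.\<close>

lemma escape_region_den:
  assumes "\<sigma>\<^sup>2 = 1" "\<sigma> * den m t > 0" "\<sigma> * rq m t \<le> 0" "4 * \<bar>rq (m - 1) t\<bar> \<le> \<sigma> * den m t" "n \<ge> m"
  shows "den n t \<noteq> 0"
proof -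
  have \<sigma>: "\<sigma> = 1 \<or> \<sigma> = - 1" using assms(1) by (simp add: power2_eq_1_iff)
  have "\<sigma> * den n t > 0"
  proof (rule escape_region[where Q = "\<lambda>n. \<sigma> * rq n t" and m = m])
    show "\<sigma> * rq (Suc n) t = - ((\<sigma> * rq (n - 1) t)\<^sup>2 / (\<sigma> * den n t))" for n
      using \<sigma> by (auto simp: rq_Suc)
    show "\<sigma> * den (Suc n) t = \<sigma> * den n t - 2 * (\<sigma> * rq n t) + 4 * (\<sigma> * rq (Suc n) t)" for n
      by (simp add: den_Suc algebra_simps)
    show "4 * \<bar>\<sigma> * rq (m - 1) t\<bar> \<le> \<sigma> * den m t" using assms(4) \<sigma> by auto
  qed (use assms in auto)
  then show ?thesis by auto
qed

text \<open>The response matrix has eigenvalues \<open>rp n t + rq n t\<close> and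
  \<open>rp n t - rq n t\<close>, and a Dirichlet-to-Neumann map does not increase in the spectral
  parameter.\<close>

lemma response_derivative:
  assumes "\<And>m. m < n \<Longrightarrow> den m t \<noteq> 0"
  obtains p' q' where "(rp n has_real_derivative p') (at t)" "(rq n has_real_derivative q') (at t)"
    "p' + q' \<le> 0" "p' - q' \<le> 0"
proof -
  have "\<exists>p' q'. (rp n has_real_derivative p') (at t) \<and> (rq n has_real_derivative q') (at t) \<and>
    p' + q' \<le> 0 \<and> p' - q' \<le> 0"
    using assms
  proof (induction n rule: G_induct)
    case 0
    have "rp 0 = (\<lambda>_. 1)" "rq 0 = (\<lambda>_. - 1)" by auto
    then show ?case by (intro exI[of _ 0]) auto
  next
    case (Suc n)
    obtain p1 q1 where 1: "(rp (n - 1) has_real_derivative p1) (at t)"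
      "(rq (n - 1) has_real_derivative q1) (at t)" "p1 + q1 \<le> 0" "p1 - q1 \<le> 0"
      using Suc.IH(2) Suc.prems by auto
    obtain p q where 2: "(rp n has_real_derivative p) (at t)"
      "(rq n has_real_derivative q) (at t)" "p + q \<le> 0" "p - q \<le> 0"
      using Suc.IH(1) Suc.prems by auto
    have d: "den n t \<noteq> 0" using Suc.prems by simp
    define D' where "D' = 2 * p1 + 2 * p + 2 * q - 1"
    have "den n = (\<lambda>t. 2 * rp (n - 1) t + 2 * rp n t + 2 * rq n t - t)" by (auto simp: den_def)
    then have dD: "(den n has_real_derivative D') (at t)"
      unfolding D'_def by (auto intro!: derivative_eq_intros 1 2 simp del: One_nat_def)
    define z where "z = rq (n - 1) t / den n t"
    define q' where "q' = z\<^sup>2 * D' - 2 * z * q1"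
    have "rq (Suc n) = (\<lambda>t. - ((rq (n - 1) t)\<^sup>2 / den n t))" by (auto simp: rq_Suc)
    then have dq: "(rq (Suc n) has_real_derivative q') (at t)"
      using d by (auto intro!: derivative_eq_intros 1 dD simp: q'_def z_def field_simps power2_eq_square simp del: One_nat_def)
    have "rp (Suc n) = (\<lambda>t. rp (n - 1) t + rq (Suc n) t)" by (auto simp: rp_Suc)
    then have dp: "(rp (Suc n) has_real_derivative (p1 + q')) (at t)"
      by (auto intro!: derivative_eq_intros 1 dq simp del: One_nat_def)
    have "z\<^sup>2 * D' \<le> z\<^sup>2 * (2 * p1)" using 2 by (intro mult_left_mono) (auto simp: D'_def)
    moreover have "- (2 * z * q1) \<le> 2 * \<bar>z\<bar> * (- p1)"
    proof -
      have "\<bar>q1\<bar> \<le> - p1" using 1 by linarith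
      then have "\<bar>z * q1\<bar> \<le> \<bar>z\<bar> * (- p1)" unfolding abs_mult by (intro mult_left_mono) auto
      then show ?thesis by linarith
    qed
    \<comment> \<open>The two bounds complete a square:
      \<open>1 - 4 * \<bar>z\<bar> + 4 * z\<^sup>2\<close>.\<close>
    ultimately have "p1 + q' + q' \<le> p1 * (1 - 2 * \<bar>z\<bar>)\<^sup>2"
      by (simp add: q'_def power2_eq_square algebra_simps)
    also have "\<dots> \<le> 0" using 1 by (intro mult_nonpos_nonneg) auto
    finally show ?case using dp dq 1 by (intro exI[of _ "p1 + q'"] exI[of _ q']) auto
  qed
  then show thesis using that by blast
qed

text \<open>The summand \<open>- t\<close> makes the decrease strict, so \<open>den\<close> passes
  from positive to negative at a first zero.\<close>

lemma den_derivative: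
  assumes "\<And>m. m < n \<Longrightarrow> den m t \<noteq> 0"
  obtains D' where "(den n has_real_derivative D') (at t)" "D' < 0"
proof -
  have lt: "m < n - 1 \<Longrightarrow> den m t \<noteq> 0" for m using assms by simp
  obtain p1 q1 where 1: "(rp (n - 1) has_real_derivative p1) (at t)"
    "(rq (n - 1) has_real_derivative q1) (at t)" "p1 + q1 \<le> 0" "p1 - q1 \<le> 0"
    using response_derivative[OF lt] .
  obtain p q where 2: "(rp n has_real_derivative p) (at t)"
    "(rq n has_real_derivative q) (at t)" "p + q \<le> 0" "p - q \<le> 0"
    using response_derivative[OF assms] .
  have "den n = (\<lambda>t. 2 * rp (n - 1) t + 2 * rp n t + 2 * rq n t - t)" by (auto simp: den_def)
  then have "(den n has_real_derivative (2 * p1 + 2 * p + 2 * q - 1)) (at t)"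
    by (auto intro!: derivative_eq_intros 1 2 simp del: One_nat_def)
  then show thesis using that 1 2 by (smt (verit))
qed

context first_zero
begin

lemma isCont_rq: "n \<le> k \<Longrightarrow> isCont (rq n) t"
  using response_derivative[of n t] den_nonzero DERIV_isCont by (metis less_le_trans)

lemma isCont_den: "n \<le> k \<Longrightarrow> isCont (den n) t"
  using den_derivative[of n t] den_nonzero DERIV_isCont by (metis less_le_trans)

text \<open>On the side of \<open>t\<close> where the pole \<open>rq (k + 1)\<close> has the sign \<open>\<sigma>\<close> of \<open>- rq k t\<close>, the
  orbit enters the escape region at step \<open>k + 3\<close>.\<close>

lemma eventually_escape:
  assumes \<sigma>: "\<sigma>\<^sup>2 = 1" "\<sigma> * rq k t < 0" and side: "\<forall>\<^sub>F x in at t within T. \<sigma> * den k x < 0"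
  shows "\<forall>\<^sub>F x in at t within T. \<forall>n. den n x \<noteq> 0"
proof -
  let ?F = "at t within T"
  have lim: "(rq n \<longlongrightarrow> rq n t) ?F" "(den n \<longlongrightarrow> den n t) ?F" if "n \<le> k" for n
    using isCont_rq[OF that] isCont_den[OF that]
    by (auto simp: isCont_def intro: tendsto_within_subset)
  \<comment> \<open>\<open>S\<close> is the reciprocal of \<open>rq (k + 1)\<close>, which has a
    pole at \<open>t\<close>. Clearing poles with \<open>S\<close>, \<open>y\<close> and
    \<open>e\<close> are the regular parts of \<open>den (k + 1)\<close> and
    \<open>den (k + 2)\<close>, \<open>c\<close> is \<open>rq (k + 2)\<close> and \<open>W\<close>
    is \<open>den (k + 3)\<close>, all with finite limits.\<close>
  define y where "y x = den k x - 2 * rq k x" for x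
  define S where "S x = - (den k x / (rq (k - 1) x)\<^sup>2)" for x
  define c where "c x = - ((rq k x)\<^sup>2 * S x / (y x * S x + 4))" for x
  define e where "e x = y x + 4 * c x" for x
  define W where "W x = y x + 2 * c x + 2 * e x / (2 + S x * e x)" for x
  have y: "(y \<longlongrightarrow> - 2 * rq k t) ?F"
    unfolding y_def using tendsto_diff[OF lim(2)[of k] tendsto_mult_left[OF lim(1)[of k]], of 2] den_zero by simp
  have S: "(S \<longlongrightarrow> 0) ?F"
    unfolding S_def using lim(1)[of "k - 1"] lim(2)[of k] beta_nonzero den_zero
    by (auto intro!: tendsto_eq_intros)
  have c: "(c \<longlongrightarrow> 0) ?F"
    unfolding c_def using lim(1)[of k] S y by (auto intro!: tendsto_eq_intros)
  have e: "(e \<longlongrightarrow> - 2 * rq k t) ?F"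
    unfolding e_def using y c by (auto intro!: tendsto_eq_intros)
  have W: "(W \<longlongrightarrow> - 4 * rq k t) ?F"
    unfolding W_def using y c e S by (auto intro!: tendsto_eq_intros)
  have ev1: "\<forall>\<^sub>F x in ?F. y x * S x + 4 > 0"
    by (rule order_tendstoD(1)[where y = 4]) (use y S in \<open>auto intro!: tendsto_eq_intros\<close>)
  have ev2: "\<forall>\<^sub>F x in ?F. 2 + S x * e x > 0"
    by (rule order_tendstoD(1)[where y = 2]) (use e S in \<open>auto intro!: tendsto_eq_intros\<close>)
  have ev3: "\<forall>\<^sub>F x in ?F. \<sigma> * W x > 0"
    by (rule order_tendstoD(1)[OF tendsto_mult_left[OF W]]) (use \<sigma> in auto)
  have ev4: "\<forall>\<^sub>F x in ?F. \<sigma> * W x - 4 * \<bar>c x\<bar> > 0"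
    by (rule order_tendstoD(1)[where y = "\<sigma> * (- 4 * rq k t) - 4 * \<bar>0\<bar>"])
      (use \<sigma> in \<open>auto intro!: tendsto_eq_intros W c\<close>)
  have ev5: "\<forall>\<^sub>F x in ?F. \<forall>m\<in>{..<k}. den m x \<noteq> 0"
    by (intro eventually_ball_finite ballI tendsto_imp_eventually_ne[OF lim(2)])
      (use den_nonzero in auto)
  show ?thesis
    using side ev1 ev2 ev3 ev4 ev5
  proof eventually_elim
    case (elim x)
    have q0: "rq (k - 1) x \<noteq> 0" by (rule rq_nonzero) (use elim in auto)
    have Sx: "\<sigma> * S x > 0" "S x \<noteq> 0"
    proof -
      have "\<sigma> * S x = - (\<sigma> * den k x) / (rq (k - 1) x)\<^sup>2" by (simp add: S_def)
      also have "\<dots> > 0" using elim(1) q0 by (intro divide_pos_pos) auto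
      finally show "\<sigma> * S x > 0" .
      then show "S x \<noteq> 0" by auto
    qed
    have q1: "rq (k + 1) x = 1 / S x" by (simp add: rq_Suc S_def)
    have d1: "den (k + 1) x = (y x * S x + 4) / S x"
      using Sx(2) q1 by (simp add: den_Suc y_def field_simps)
    have q2: "rq (k + 2) x = c x"
      using d1 by (simp add: rq_Suc[of "Suc k"] c_def)
    have d2: "den (k + 2) x = (2 + S x * e x) / S x"
      using Sx(2) q1 q2 d1 by (simp add: den_Suc[of "Suc k"] e_def field_simps)
    have q3: "rq (k + 3) x = - (1 / (S x * (2 + S x * e x)))"
    proof -
      have "rq (k + 3) x = - ((rq (k + 1) x)\<^sup>2 / den (k + 2) x)"
        using rq_Suc[of "k + 2" x] by (simp add: numeral_3_eq_3)
      also have "\<dots> = - (1 / (S x * (2 + S x * e x)))"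
        unfolding q1 d2 using Sx(2) by (simp add: power2_eq_square)
      finally show ?thesis .
    qed
    have d3: "den (k + 3) x = W x"
    proof -
      have "den (k + 3) x = den (k + 2) x - 2 * rq (k + 2) x + 4 * rq (k + 3) x"
        using den_Suc[of "k + 2" x] by (simp add: numeral_3_eq_3)
      also have "\<dots> = (2 + S x * e x) / S x - 2 * c x - 4 / (S x * (2 + S x * e x))"
        unfolding d2 q2 q3 by simp
      also have "(2 + S x * e x) / S x - 4 / (S x * (2 + S x * e x)) =
          ((2 + S x * e x)\<^sup>2 - 4) / (S x * (2 + S x * e x))"
      proof -
        have "u / s - 4 / (s * u) = (u\<^sup>2 - 4) / (s * u)" if "s \<noteq> 0" "u \<noteq> 0" for s u :: real
          using that by (simp add: divide_simps power2_eq_square)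
        then show ?thesis using Sx(2) elim(3) by force
      qed
      then have "(2 + S x * e x) / S x - 2 * c x - 4 / (S x * (2 + S x * e x)) =
          ((2 + S x * e x)\<^sup>2 - 4) / (S x * (2 + S x * e x)) - 2 * c x" by simp
      \<comment> \<open>The numerator is divisible by \<open>S x\<close>: the poles cancel in
        \<open>den (k + 3)\<close>.\<close>
      also have "(2 + S x * e x)\<^sup>2 - 4 = S x * (e x * (2 + S x * e x) + 2 * e x)"
        by (simp add: power2_eq_square algebra_simps)
      also have "S x * (e x * (2 + S x * e x) + 2 * e x) / (S x * (2 + S x * e x)) =
          e x + 2 * e x / (2 + S x * e x)"
        using Sx(2) elim(3) by (simp add: add_divide_distrib)
      also have "e x + 2 * e x / (2 + S x * e x) - 2 * c x = W x" by (simp add: W_def e_def)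
      finally show ?thesis .
    qed
    have "\<sigma> * rq (k + 3) x \<le> 0"
    proof -
      have "\<sigma> * (1 / (S x * (2 + S x * e x))) = (\<sigma> * S x) / ((S x)\<^sup>2 * (2 + S x * e x))"
        using Sx(2) by (simp add: power2_eq_square)
      also have "\<dots> \<ge> 0" using Sx(1) elim(3) by (intro divide_nonneg_nonneg) auto
      finally show ?thesis by (simp add: q3)
    qed
    moreover have "4 * \<bar>rq (k + 3 - 1) x\<bar> \<le> \<sigma> * den (k + 3) x"
      using elim(5) q2 d3 by (simp add: numeral_3_eq_3)
    \<comment> \<open>The escape region takes over at \<open>k + 3\<close>; below \<open>k\<close>
      continuity suffices, and levels \<open>k\<close> to \<open>k + 2\<close> follow from the
      explicit formulas.\<close>
    ultimately have "den n x \<noteq> 0" if "n \<ge> k + 3" for n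
      using escape_region_den[OF \<sigma>(1), of "k + 3" x n] elim(4) d3 that by simp
    moreover have "den k x \<noteq> 0" "den (k + 1) x \<noteq> 0" "den (k + 2) x \<noteq> 0"
      using elim d1 d2 Sx by auto
    moreover have "n < k \<or> n = k \<or> n = k + 1 \<or> n = k + 2 \<or> n \<ge> k + 3" for n by linarith
    ultimately show ?case using elim(6) by (metis lessThan_iff)
  qed
qed

text \<open>\<open>den k\<close> decreases through 0 at \<open>t\<close>, so its sign on each side
  is known. The gap lies to the right if \<open>rq k t\<close> is negative and to the left if it is
  positive.\<close>

lemma one_sided_gap:
  obtains \<delta> where "\<delta> > 0"
    "(\<forall>x. t < x \<and> x < t + \<delta> \<longrightarrow> (\<forall>n. x \<notin> dirichlet_spec n)) \<or>
     (\<forall>x. t - \<delta> < x \<and> x < t \<longrightarrow> (\<forall>n. x \<notin> dirichlet_spec n))"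
proof -
  have spec: "x \<notin> dirichlet_spec n" if "\<forall>n. den n x \<noteq> 0" for x n
    using that dirichlet_specE by metis
  obtain D' where D': "(den k has_real_derivative D') (at t)" "D' < 0"
    using den_derivative den_nonzero by metis
  have "rq k t \<noteq> 0" using rq_nonzero den_nonzero by blast
  then consider "rq k t < 0" | "rq k t > 0" by linarith
  then show thesis
  proof cases
    case 1
    obtain d where d: "d > 0" "\<And>h. 0 < h \<Longrightarrow> h < d \<Longrightarrow> den k (t + h) < den k t"
      using DERIV_neg_dec_right[OF D'] by auto
    have "den k x < 0" if "t < x" "x < t + d" for x
      using d(2)[of "x - t"] that den_zero by simp
    then have "\<forall>\<^sub>F x in at_right t. 1 * den k x < 0"
      unfolding eventually_at_right_field using d(1) by (intro exI[of _ "t + d"]) auto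
    then have "\<forall>\<^sub>F x in at_right t. \<forall>n. den n x \<noteq> 0"
      by (rule eventually_escape[rotated 2]) (use 1 in auto)
    then obtain b where "b > t" "\<And>x. t < x \<Longrightarrow> x < b \<Longrightarrow> \<forall>n. den n x \<noteq> 0"
      unfolding eventually_at_right_field by auto
    then show thesis using spec by (intro that[of "b - t"]) auto
  next
    case 2
    obtain d where d: "d > 0" "\<And>h. 0 < h \<Longrightarrow> h < d \<Longrightarrow> den k (t - h) > den k t"
      using DERIV_neg_dec_left[OF D'] by auto
    have "den k x > 0" if "t - d < x" "x < t" for x
      using d(2)[of "t - x"] that den_zero by simp
    then have "\<forall>\<^sub>F x in at_left t. - 1 * den k x < 0"
      unfolding eventually_at_left_field using d(1) by (intro exI[of _ "t - d"]) auto
    then have "\<forall>\<^sub>F x in at_left t. \<forall>n. den n x \<noteq> 0"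
      by (rule eventually_escape[rotated 2]) (use 2 in auto)
    then obtain b where "b < t" "\<And>x. b < x \<Longrightarrow> x < t \<Longrightarrow> \<forall>n. den n x \<noteq> 0"
      unfolding eventually_at_left_field by auto
    then show thesis using spec by (intro that[of "t - b"]) auto
  qed
qed

end

section \<open>Topology of the closure of the Dirichlet eigenvalues\<close>

lemma first_zeroE:
  assumes "t \<in> dirichlet_spec n"
  obtains k where "first_zero k t"
  using dirichlet_specE[OF assms] unfolding first_zero_def by metis

definition dirichlet_set :: "real set" where
  "dirichlet_set = (\<Union>n. dirichlet_spec n)"

lemma Cantor_closure_dirichlet_set: "Cantor_set (closure dirichlet_set)"
proof -
  let ?K = "closure dirichlet_set"
  \<comment> \<open>Nonemptiness: 2 is the Dirichlet eigenvalue of \<open>G 1\<close>.\<close>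
  have "den 0 2 = 0" by (simp add: den_0)
  then interpret two: first_zero 0 2 by unfold_locales auto
  obtain \<phi> where "dirichlet \<phi>" "response (Suc 0) 2 \<phi> two.\<beta> two.\<beta>" "\<phi> Ctr = 1"
    using two.ground_state .
  moreover from this have "ip (Suc 0) \<phi> \<phi> > 0" by (simp add: ip_Suc add_pos_nonneg ip_nonneg)
  ultimately have "2 \<in> dirichlet_set" by (auto simp: dirichlet_set_def dirichlet_spec_def)
  then have "?K \<noteq> {}" using closure_subset by auto
  moreover have "bounded dirichlet_set"
    by (rule bounded_subset[of "{0..8}"]) (auto simp: dirichlet_set_def dest: dirichlet_spec_bounds)
  then have "compact ?K" by (simp add: compact_closure)
  moreover have "x islimpt ?K" if "x \<in> ?K" for x
  proof -
    have lim: "t islimpt dirichlet_set" if t: "t \<in> dirichlet_set" for t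
    proof -
      obtain n where "t \<in> dirichlet_spec n" using t by (auto simp: dirichlet_set_def)
      then obtain k where "first_zero k t" using first_zeroE by blast
      then have "\<exists>s\<in>dirichlet_set. s \<noteq> t \<and> dist s t < e" if "e > 0" for e
      proof -
        obtain n s where "s \<in> dirichlet_spec n" "s \<noteq> t" "\<bar>s - t\<bar> < e"
          using first_zero.nearby_eigenvalue[OF \<open>first_zero k t\<close> \<open>e > 0\<close>] .
        then show ?thesis by (auto simp: dirichlet_set_def dist_real_def)
      qed
      then show ?thesis by (simp add: islimpt_approachable)
    qed
    have "x islimpt dirichlet_set"
      using that lim by (auto simp: closure_def)
    then show ?thesis by (rule islimpt_subset) (rule closure_subset)
  qed
  moreover have "totally_disconnected ?K"
    unfolding totally_disconnected_def
  proof (intro allI impI ballI)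
    fix T x y assume T: "T \<subseteq> ?K \<and> connected T" and "x \<in> T" "y \<in> T"
    \<comment> \<open>A nondegenerate interval in \<open>?K\<close> would have a Dirichlet
      eigenvalue in its interior, which contradicts the one-sided gap there.\<close>
    have False if "a < b" "a \<in> T" "b \<in> T" for a b
    proof -
      have "{a..b} \<subseteq> ?K"
        using T that connected_contains_Icc by blast
      then have sub: "{a<..<b} \<subseteq> ?K" using greaterThanLessThan_subseteq_atLeastAtMost_iff by force
      have "{a<..<b} \<inter> dirichlet_set \<noteq> {}"
        using sub \<open>a < b\<close> open_Int_closure_eq_empty[of "{a<..<b}" dirichlet_set]
        by (metis Int_absorb2 greaterThanLessThan_empty_iff not_le open_greaterThanLessThan)
      then obtain t where t: "a < t" "t < b" "t \<in> dirichlet_set" by auto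
      from t(3) obtain n where "t \<in> dirichlet_spec n" by (auto simp: dirichlet_set_def)
      then obtain k where "first_zero k t" using first_zeroE by blast
      then obtain \<delta> where \<delta>: "\<delta> > 0" "(\<forall>x. t < x \<and> x < t + \<delta> \<longrightarrow> (\<forall>n. x \<notin> dirichlet_spec n)) \<or>
          (\<forall>x. t - \<delta> < x \<and> x < t \<longrightarrow> (\<forall>n. x \<notin> dirichlet_spec n))"
        using first_zero.one_sided_gap by metis
      define c d where "c = min b (t + \<delta>)" and "d = max a (t - \<delta>)"
      have cd: "t < c" "d < t" using t \<delta>(1) by (auto simp: c_def d_def)
      have gap: "dirichlet_set \<inter> {t<..<c} = {} \<or> dirichlet_set \<inter> {d<..<t} = {}"
        using \<delta>(2) by (auto simp: dirichlet_set_def c_def d_def)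
      have "{t<..<c} \<noteq> {}" "{d<..<t} \<noteq> {}" using cd by auto
      moreover have "{t<..<c} \<subseteq> ?K" "{d<..<t} \<subseteq> ?K"
        using sub t by (auto simp: c_def d_def subset_eq)
      ultimately show False
        using gap open_Int_closure_eq_empty[of "{t<..<c}" dirichlet_set]
          open_Int_closure_eq_empty[of "{d<..<t}" dirichlet_set]
        by (metis Int_absorb2 Int_commute open_greaterThanLessThan)
    qed
    then show "x = y" using \<open>x \<in> T\<close> \<open>y \<in> T\<close> by (metis linorder_neqE)
  qed
  ultimately show ?thesis by (simp add: Cantor_set_def)
qed

section \<open>Eigenfunctions on \<open>\<Gamma>\<^sub>n\<close>\<close>

abbreviation gon1 :: "(addr \<Rightarrow> real) \<Rightarrow> addr \<Rightarrow> real" where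
  "gon1 f \<equiv> \<lambda>x. f (place Ctr Ctr Cp1 x)"
abbreviation gon2 :: "(addr \<Rightarrow> real) \<Rightarrow> addr \<Rightarrow> real" where
  "gon2 f \<equiv> \<lambda>x. f (place Ctr Ctr Cp2 x)"

fun gjoin :: "(addr \<Rightarrow> real) \<Rightarrow> (addr \<Rightarrow> real) \<Rightarrow> addr \<Rightarrow> real" where
  "gjoin u w Ctr = u Bd1"
| "gjoin u w (Cp1 x) = u x"
| "gjoin u w (Cp2 x) = w x"
| "gjoin u w _ = 0"

lemma gon1_gjoin: "u Bd2 = u Bd1 \<Longrightarrow> gon1 (gjoin u w) = u"
proof
  show "gon1 (gjoin u w) x = u x" if "u Bd2 = u Bd1" for x using that by (cases x) auto
qed

lemma gon2_gjoin: "w Bd1 = u Bd1 \<Longrightarrow> w Bd2 = u Bd1 \<Longrightarrow> gon2 (gjoin u w) = w"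
proof
  show "gon2 (gjoin u w) x = w x" if "w Bd1 = u Bd1" "w Bd2 = u Bd1" for x
    using that by (cases x) auto
qed

lemma sum_verts_\<Gamma>:
  "(\<Sum>x\<in>verts (\<Gamma> n). h x) = h Ctr + (\<Sum>x\<in>inner_verts n. h (Cp1 x)) + (\<Sum>x\<in>inner_verts (n - 1). h (Cp2 x))"
proof -
  have "(\<Sum>x\<in>verts (\<Gamma> n). h x) = h Ctr + (sum h (Cp1 ` inner_verts n) + sum h (Cp2 ` inner_verts (n - 1)))"
    unfolding verts_\<Gamma> by (subst sum.insert, simp, force) (subst sum.union_disjoint, simp, simp, force, simp)
  then show ?thesis by (simp add: sum.reindex inj_on_def add.assoc)
qed

lemma \<Gamma>_form_eq:
  "energy (\<Gamma> n) f k - t * (\<Sum>x\<in>verts (\<Gamma> n). f x * k x) =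
    form n t (gon1 f) (gon1 k) + form (n - 1) t (gon2 f) (gon2 k) - t * f Ctr * k Ctr"
  unfolding sum_verts_\<Gamma> form_def ip_def
  by (simp add: \<Gamma>_eq energy_map_graph energy_union_graph place_inner_verts algebra_simps del: \<Gamma>.simps)

lemma eigenspace_\<Gamma>_iff:
  "f \<in> eigenspace (\<Gamma> n) t \<longleftrightarrow> (\<forall>x. x \<notin> verts (\<Gamma> n) \<longrightarrow> f x = 0) \<and>
    (\<forall>k. energy (\<Gamma> n) f k = t * (\<Sum>x\<in>verts (\<Gamma> n). f x * k x))"
proof -
  have fin: "finite (verts (\<Gamma> n))" using wf_\<Gamma> by (simp add: wf_graph_def)
  have "(\<forall>x\<in>verts (\<Gamma> n). laplacian (\<Gamma> n) f x = t * f x) \<longleftrightarrow>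
    (\<forall>k. energy (\<Gamma> n) f k = t * (\<Sum>x\<in>verts (\<Gamma> n). f x * k x))"
  proof safe
    fix k assume "\<forall>x\<in>verts (\<Gamma> n). laplacian (\<Gamma> n) f x = t * f x"
    then show "energy (\<Gamma> n) f k = t * (\<Sum>x\<in>verts (\<Gamma> n). f x * k x)"
      by (simp add: sum_laplacian[OF wf_\<Gamma>, symmetric] sum_distrib_left mult_ac)
  next
    fix x assume *: "\<forall>k. energy (\<Gamma> n) f k = t * (\<Sum>x\<in>verts (\<Gamma> n). f x * k x)" and x: "x \<in> verts (\<Gamma> n)"
    have "(\<Sum>y\<in>verts (\<Gamma> n). f y * of_bool (y = x)) = (\<Sum>y\<in>verts (\<Gamma> n). if y = x then f y else 0)"
      by (intro sum.cong) auto
    then show "laplacian (\<Gamma> n) f x = t * f x"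
      unfolding laplacian_eq_energy[OF wf_\<Gamma> x] *[rule_format] using fin x by simp
  qed
  then show ?thesis by (auto simp: eigenspace_def)
qed

lemma eigenspace_\<Gamma>_split:
  assumes "f \<in> eigenspace (\<Gamma> n) t"
  obtains l1 l2 m1 m2 where "response n t (gon1 f) l1 l2" "response (n - 1) t (gon2 f) m1 m2"
    "l1 + l2 + m1 + m2 = t * f Ctr"
proof -
  have test: "form n t (gon1 f) u + form (n - 1) t (gon2 f) w - t * f Ctr * u Bd1 = 0"
    if "u Bd2 = u Bd1" "w Bd1 = u Bd1" "w Bd2 = u Bd1" for u w
    using assms \<Gamma>_form_eq[of n f "gjoin u w" t] gon1_gjoin[OF that(1)] gon2_gjoin[of w u, OF that(2,3)]
    by (simp add: eigenspace_\<Gamma>_iff)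
  obtain l1 l2 where 1: "response n t (gon1 f) l1 l2"
    using test[of _ "\<lambda>_. 0"] by (rule_tac response_exists) auto
  obtain m1 m2 where 2: "response (n - 1) t (gon2 f) m1 m2"
    using test[of "\<lambda>_. 0"] by (rule_tac response_exists) auto
  have "l1 + l2 + m1 + m2 = t * f Ctr"
    using test[of "\<lambda>_. 1" "\<lambda>_. 1"] by (simp add: responseD[OF 1] responseD[OF 2] del: One_nat_def)
  then show thesis using that 1 2 by blast
qed

lemma eigenspace_\<Gamma>I:
  assumes "response n t (gon1 f) l1 l2" "response (n - 1) t (gon2 f) m1 m2"
    "l1 + l2 + m1 + m2 = t * f Ctr" "\<And>x. x \<notin> verts (\<Gamma> n) \<Longrightarrow> f x = 0"
  shows "f \<in> eigenspace (\<Gamma> n) t"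
proof -
  have "energy (\<Gamma> n) f k - t * (\<Sum>x\<in>verts (\<Gamma> n). f x * k x) = 0" for k
    unfolding \<Gamma>_form_eq responseD[OF assms(1)] responseD[OF assms(2)] assms(3)[symmetric]
    by (simp add: algebra_simps)
  then show ?thesis unfolding eigenspace_\<Gamma>_iff using assms(4) by simp
qed

text \<open>An eigenfunction vanishing at \<open>Ctr\<close> is already Dirichlet on both copies.
  Otherwise it is scaled to 1 at \<open>Ctr\<close>, and each lift adds an inner vertex with value
  1, which makes the norm grow.\<close>

lemma Spec_\<Gamma>_approx:
  assumes "t \<in> Spec (\<Gamma> n)" "\<epsilon> > 0"
  obtains s m where "s \<in> dirichlet_spec m" "\<bar>s - t\<bar> < \<epsilon>"
proof -
  obtain f where f: "f \<in> eigenspace (\<Gamma> n) t" "f \<noteq> 0" using assms(1) by (auto simp: Spec_def)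
  obtain l1 l2 m1 m2 where r: "response n t (gon1 f) l1 l2" "response (n - 1) t (gon2 f) m1 m2"
    "l1 + l2 + m1 + m2 = t * f Ctr" using eigenspace_\<Gamma>_split[OF f(1)] .
  show thesis
  proof (cases "f Ctr = 0")
    case True
    then have d: "dirichlet (gon1 f)" "dirichlet (gon2 f)" by (auto simp: dirichlet_def)
    obtain x where "f x \<noteq> 0" using f(2) by (auto simp: fun_eq_iff)
    then have "x \<in> verts (\<Gamma> n)" using f(1) by (auto simp: eigenspace_def)
    then have "ip n (gon1 f) (gon1 f) \<noteq> 0 \<or> ip (n - 1) (gon2 f) (gon2 f) \<noteq> 0"
      using \<open>f x \<noteq> 0\<close> True unfolding verts_\<Gamma> ip_eq_0_iff by (auto simp: place_inner_verts)
    then have "ip n (gon1 f) (gon1 f) > 0 \<or> ip (n - 1) (gon2 f) (gon2 f) > 0"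
      using ip_nonneg by (metis less_eq_real_def)
    then have "t \<in> dirichlet_spec n \<or> t \<in> dirichlet_spec (n - 1)"
      using d r unfolding dirichlet_spec_def by blast
    then show thesis using that assms(2) by force
  next
    case False
    let ?c = "1 / f Ctr"
    \<comment> \<open>One level up, the pair \<open>u\<close>, \<open>w\<close> becomes
      \<open>join w w u\<close>, \<open>u\<close>: the same four fluxes balance both at the new
      inner centre and at the gluing vertex.\<close>
    have lift: "\<exists>u w l1 l2 m1 m2. response (n + i) t u l1 l2 \<and> response (n + i - 1) t w m1 m2 \<and>
        u Bd1 = 1 \<and> u Bd2 = 1 \<and> w Bd1 = 1 \<and> w Bd2 = 1 \<and> l1 + l2 + m1 + m2 = t \<and> ip (n + i) u u \<ge> i" for i
    proof (induction i)
      case 0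
      have "?c * l1 + ?c * l2 + ?c * m1 + ?c * m2 = ?c * (l1 + l2 + m1 + m2)" by (simp only: distrib_left)
      also have "\<dots> = t" unfolding r(3) using False by simp
      finally show ?case
        using response_scale[OF r(1), of ?c] response_scale[OF r(2), of ?c] False
        by (intro exI[of _ "\<lambda>x. ?c * gon1 f x"] exI[of _ "\<lambda>x. ?c * gon2 f x"] exI[of _ "?c * l1"]
            exI[of _ "?c * l2"] exI[of _ "?c * m1"] exI[of _ "?c * m2"] conjI)
          (simp_all add: ip_nonneg)
    next
      case (Suc i)
      then obtain u w l1 l2 m1 m2 where u: "response (n + i) t u l1 l2" "response (n + i - 1) t w m1 m2"
        "u Bd1 = 1" "u Bd2 = 1" "w Bd1 = 1" "w Bd2 = 1" "l1 + l2 + m1 + m2 = t" "ip (n + i) u u \<ge> i" by blast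
      let ?u = "join w w u"
      have "response (Suc (n + i)) t ?u m1 m2"
        using u by (intro response_join[OF u(2) u(2) u(1) u(6) u(5) u(3,4)]) (simp add: algebra_simps)
      moreover have on: "on1 ?u = w" "on2 ?u = w" "on3 ?u = u" "?u Ctr = 1" using u by simp_all
      have "ip (Suc (n + i)) ?u ?u \<ge> real (Suc i)"
        unfolding ip_Suc on using u(8) ip_nonneg[of "n + i - 1" w] by simp
      ultimately show ?case using u
        by (intro exI[of _ ?u] exI[of _ u] exI[of _ m1] exI[of _ m2] exI[of _ l1] exI[of _ l2]) simp
    qed
    obtain i :: nat where i: "32 / \<epsilon>\<^sup>2 < i" using reals_Archimedean2 by blast
    obtain u l1 l2 where u: "response (n + i) t u l1 l2" "u Bd1 = 1" "u Bd2 = 1" "ip (n + i) u u \<ge> i"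
      using lift[of i] by blast
    define m where "m = n + i"
    \<comment> \<open>Subtracting \<open>d\<close> cuts \<open>u\<close> off at the boundary without
      changing inner values.\<close>
    define d :: "addr \<Rightarrow> real" where "d x = of_bool (x = Bd1 \<or> x = Bd2)" for x
    define v where "v x = u x + - 1 * d x" for x
    have d0: "ip m d k = 0" for k by (auto simp: ip_def d_def intro!: sum.neutral)
    have ipv: "ip m v k = ip m u k" for k
      unfolding v_def[abs_def] ip_add_left ip_scale_left by (simp add: d0)
    have vv: "ip m v v \<ge> i" using u(4) ipv[of v] ipv[of u] ip_commute[of m u v] unfolding m_def by linarith
    have dv: "dirichlet v" using u by (simp add: dirichlet_def v_def d_def)
    have form_v: "(form m t v k)\<^sup>2 \<le> 32 * ip m k k" if k: "dirichlet k" for k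
    proof -
      have "form m t u k = 0" using responseD[OF u(1), of k] k by (simp add: dirichlet_def m_def)
      then have fv: "form m t v k = - energy (G m) d k"
        unfolding v_def[abs_def] form_add_left form_scale_left by (simp add: form_def d0)
      \<comment> \<open>Cauchy-Schwarz by a nonnegative quadratic in \<open>c\<close>; the bound 32
        is 4, for the energy of \<open>d\<close>, times 8, from \<open>energy_le\<close> for
        \<open>k\<close>.\<close>
      have q: "0 \<le> 4 + 2 * c * energy (G m) d k + 8 * c\<^sup>2 * ip m k k" for c
      proof -
        have "0 \<le> energy (G m) (\<lambda>x. d x + c * k x) (\<lambda>x. d x + c * k x)" by (rule energy_nonneg)
        also have "\<dots> = energy (G m) d d + 2 * c * energy (G m) d k + c\<^sup>2 * energy (G m) k k"
          unfolding energy_add_left energy_scale_left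
          unfolding energy_commute[of _ _ "\<lambda>x. d x + c * k x"] energy_add_left energy_scale_left
          by (simp add: energy_commute[of _ k d] power2_eq_square algebra_simps)
        also have "energy (G m) d d \<le> 4"
          using energy_le[of m d] by (simp add: d0 d_def)
        also have "c\<^sup>2 * energy (G m) k k \<le> c\<^sup>2 * (8 * ip m k k)"
          using energy_le[of m k] k by (intro mult_left_mono) (auto simp: dirichlet_def)
        finally show ?thesis by simp
      qed
      have "(energy (G m) d k)\<^sup>2 \<le> 32 * ip m k k"
      proof (cases "ip m k k = 0")
        case True
        have "0 \<le> 4 - 2 * r * (energy (G m) d k)\<^sup>2" for r
          using q[of "- r * energy (G m) d k"] True by (simp add: power2_eq_square algebra_simps)
        then have "2 * r * (energy (G m) d k)\<^sup>2 \<le> 4" for r by (simp add: algebra_simps)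
        from this[of "3 / (energy (G m) d k)\<^sup>2"] show ?thesis using True
          by (cases "energy (G m) d k = 0") simp_all
      next
        case False
        then have pos: "ip m k k > 0" using ip_nonneg[of m k] by simp
        have "0 \<le> 4 - (energy (G m) d k)\<^sup>2 / (8 * ip m k k)"
          using q[of "- energy (G m) d k / (8 * ip m k k)"] pos
          by (simp add: power2_eq_square field_simps)
        then show ?thesis using pos by (simp add: field_simps)
      qed
      then show ?thesis using fv by simp
    qed
    show thesis
    \<comment> \<open>If \<open>t\<close> is no Dirichlet eigenvalue at level \<open>m\<close>, the
      orthogonality required below is trivial.\<close>
    proof (cases "t \<in> dirichlet_spec m")
      case True
      then show thesis using that assms(2) by force
    next
      case False
      have i0: "real i > 0" using i assms(2) by (meson divide_pos_pos less_trans zero_less_numeral zero_less_power)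
      obtain s where s: "s \<in> dirichlet_spec m" "(s - t)\<^sup>2 * ip m v v \<le> 32"
      proof (rule approx_dirichlet_spec[OF dv _ _ form_v])
        show "ip m v v > 0" using vv i0 by linarith
        show "ip m v h = 0" if "dirichlet h" "response m t h j1 j2" for h j1 j2
        proof -
          have "\<not> ip m h h > 0" using that False by (auto simp: dirichlet_spec_def)
          then have "ip m h h = 0" using ip_nonneg[of m h] by simp
          then show ?thesis using ip_zeroD ip_commute by metis
        qed
      qed blast
      have "(s - t)\<^sup>2 * real i \<le> (s - t)\<^sup>2 * ip m v v" using vv by (intro mult_left_mono) auto
      also have "\<dots> \<le> 32" by (rule s)
      also have "32 < \<epsilon>\<^sup>2 * real i" using i assms(2) by (simp add: field_simps)
      finally have "(s - t)\<^sup>2 < \<epsilon>\<^sup>2" using i0 by simp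
      then have "\<bar>s - t\<bar> < \<epsilon>" using assms(2) power2_less_imp_less[of "\<bar>s - t\<bar>" \<epsilon>] by simp
      then show thesis using that s by blast
    qed
  qed
qed

section \<open>Multiplicity of the localized eigenfunctions\<close>

text \<open>The dual points \<open>X\<close> make linear independence immediate and are preserved by gluing.\<close>

definition localized_family :: "nat \<Rightarrow> real \<Rightarrow> nat \<Rightarrow> bool" where
  "localized_family n t c \<longleftrightarrow> (\<exists>X\<subseteq>inner_verts n. card X = c \<and>
    (\<forall>x\<in>X. \<exists>h. dirichlet h \<and> response n t h 0 0 \<and> h x = 1 \<and> (\<forall>y\<in>X - {x}. h y = 0)))"

lemma localized_family_0: "localized_family n t 0"
  unfolding localized_family_def by (intro exI[of _ "{}"]) auto

text \<open>Without boundary values and fluxes, each function extends by zero from its copy; dual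
  points in different copies stay distinct.\<close>

lemma localized_family_Suc:
  assumes "localized_family n t c" "localized_family (n - 1) t c'"
  shows "localized_family (Suc n) t (c + 2 * c')"
proof -
  obtain X where X: "X \<subseteq> inner_verts n" "card X = c"
    "\<And>x. x \<in> X \<Longrightarrow> \<exists>h. dirichlet h \<and> response n t h 0 0 \<and> h x = 1 \<and> (\<forall>y\<in>X - {x}. h y = 0)"
    using assms(1) unfolding localized_family_def by blast
  obtain Y where Y: "Y \<subseteq> inner_verts (n - 1)" "card Y = c'"
    "\<And>x. x \<in> Y \<Longrightarrow> \<exists>h. dirichlet h \<and> response (n - 1) t h 0 0 \<and> h x = 1 \<and> (\<forall>y\<in>Y - {x}. h y = 0)"
    using assms(2) unfolding localized_family_def by blast
  have fin: "finite X" "finite Y" using X(1) Y(1) finite_inner_verts finite_subset by blast+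
  let ?Z = "Cp3 ` X \<union> (Cp1 ` Y \<union> Cp2 ` Y)"
  have "card ?Z = card (Cp3 ` X) + card (Cp1 ` Y \<union> Cp2 ` Y)"
    using fin by (intro card_Un_disjoint) auto
  also have "card (Cp1 ` Y \<union> Cp2 ` Y) = card (Cp1 ` Y) + card (Cp2 ` Y)"
    using fin by (intro card_Un_disjoint) auto
  finally have card: "card ?Z = c + 2 * c'" using X(2) Y(2) by (simp add: card_image inj_on_def)
  have "\<exists>h. dirichlet h \<and> response (Suc n) t h 0 0 \<and> h z = 1 \<and> (\<forall>y\<in>?Z - {z}. h y = 0)" if z: "z \<in> ?Z" for z
  proof -
    have R: "response (Suc n) t (join f1 f2 f3) 0 0" if "dirichlet f1" "dirichlet f2" "dirichlet f3"
      "response (n - 1) t f1 0 0" "response (n - 1) t f2 0 0" "response n t f3 0 0" for f1 f2 f3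
      using that by (intro response_join[OF that(4-6), where z = 0]) (auto simp: dirichlet_def)
    have d0: "dirichlet (\<lambda>_. 0)" by (simp add: dirichlet_def)
    from z consider x where "x \<in> X" "z = Cp3 x" | x where "x \<in> Y" "z = Cp1 x" | x where "x \<in> Y" "z = Cp2 x"
      by auto
    then show ?thesis
    proof cases
      case 1
      then obtain h where h: "dirichlet h" "response n t h 0 0" "h x = 1" "\<forall>y\<in>X - {x}. h y = 0" using X(3) by blast
      then show ?thesis using 1 R[OF d0 d0 h(1) response_zero response_zero h(2)]
        by (intro exI[of _ "join (\<lambda>_. 0) (\<lambda>_. 0) h"] conjI) (auto simp: dirichlet_def)
    next
      case 2
      then obtain h where h: "dirichlet h" "response (n - 1) t h 0 0" "h x = 1" "\<forall>y\<in>Y - {x}. h y = 0" using Y(3) by blast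
      then show ?thesis using 2 R[OF h(1) d0 d0 h(2) response_zero response_zero]
        by (intro exI[of _ "join h (\<lambda>_. 0) (\<lambda>_. 0)"] conjI) (auto simp: dirichlet_def)
    next
      case 3
      then obtain h where h: "dirichlet h" "response (n - 1) t h 0 0" "h x = 1" "\<forall>y\<in>Y - {x}. h y = 0" using Y(3) by blast
      then show ?thesis using 3 R[OF d0 h(1) d0 response_zero h(2) response_zero]
        by (intro exI[of _ "join (\<lambda>_. 0) h (\<lambda>_. 0)"] conjI) (auto simp: dirichlet_def)
    qed
  qed
  moreover have "?Z \<subseteq> inner_verts (Suc n)" using X(1) Y(1) by (auto simp: inner_verts_Suc)
  ultimately show ?thesis unfolding localized_family_def using card
    by (intro exI[of _ ?Z] conjI ballI) simp_all
qed

text \<open>The counts follow the recursion of the powers of 2, which is \<open>c + 2 * c'\<close>;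
  the factor 2 in the bound allows for a single function on each of the first two levels.\<close>

lemma (in first_zero) localized_family_growth:
  "\<exists>c. localized_family (k + 4 + j) t c \<and> 2 ^ j \<le> 2 * c"
proof -
  obtain h where h: "dirichlet h" "response (k + 4) t h 0 0" "ip (k + 4) h h > 0"
    using localized_eigenfunction .
  then have "ip (k + 4) h h \<noteq> 0" by simp
  then obtain x where x: "x \<in> inner_verts (k + 4)" "h x \<noteq> 0" unfolding ip_eq_0_iff by blast
  have "response (k + 4) t (\<lambda>y. (1 / h x) * h y) ((1 / h x) * 0) ((1 / h x) * 0)"
    by (rule response_scale[OF h(2)])
  then have base: "localized_family (k + 4) t 1"
    unfolding localized_family_def using x h(1)
    by (intro exI[of _ "{x}"]) (auto simp: dirichlet_def intro!: exI[of _ "\<lambda>y. (1 / h x) * h y"])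
  show ?thesis
  proof (induction j rule: induct_nat_012)
    case 0
    then show ?case using base by (intro exI[of _ 1]) simp
  next
    case 1
    have "localized_family (Suc (k + 4)) t (1 + 2 * 0)"
      by (rule localized_family_Suc[OF base localized_family_0])
    then show ?case by (intro exI[of _ 1]) simp
next
  case (ge2 j)
  obtain c where c: "localized_family (k + 4 + Suc j) t c" "2 ^ Suc j \<le> 2 * c" using ge2 by blast
  obtain c' where c': "localized_family (k + 4 + j) t c'" "2 ^ j \<le> 2 * c'" using ge2 by blast
  have "localized_family (Suc (k + 4 + Suc j)) t (c + 2 * c')"
  proof (rule localized_family_Suc[OF c(1)])
    have "k + 4 + Suc j - 1 = k + 4 + j" by simp
    then show "localized_family (k + 4 + Suc j - 1) t c'" using c'(1) by (simp only:)
  qed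
  then show ?case using c(2) c'(2) by (intro exI[of _ "c + 2 * c'"]) simp
  qed
qed

section \<open>Dimensions of spaces of functions on a finite set\<close>

lemma sum_fun_apply: "(\<Sum>v\<in>S. F v) x = (\<Sum>v\<in>S. F v x)" for F :: "'b \<Rightarrow> 'a \<Rightarrow> real"
  by (induction S rule: infinite_finite_induct) auto

lemma finite_support_span:
  assumes "finite V"
  obtains T :: "('a \<Rightarrow> real) set" where "finite T"
    "{f. \<forall>x. x \<notin> V \<longrightarrow> f x = 0} \<subseteq> module.span (\<lambda>c f x. c * f x) T"
proof -
  interpret vs: vector_space "\<lambda>(c::real) (f::'a \<Rightarrow> real) x. c * f x" by (rule vector_space_fun)
  let ?d = "\<lambda>y x. of_bool (x = y) :: real"
  have "f \<in> vs.span (?d ` V)" if "\<forall>x. x \<notin> V \<longrightarrow> f x = 0" for f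
  proof -
    have "(\<Sum>y\<in>V. (\<lambda>x. f y * ?d y x)) \<in> vs.span (?d ` V)"
      by (intro vs.span_sum vs.span_scale vs.span_base) auto
    moreover have "(\<Sum>y\<in>V. (\<lambda>x. f y * ?d y x)) = f"
    proof
      fix x
      have "(\<Sum>y\<in>V. f y * ?d y x) = (\<Sum>y\<in>V. if y = x then f y else 0)"
        by (intro sum.cong) auto
      then show "(\<Sum>y\<in>V. (\<lambda>x. f y * ?d y x)) x = f x"
        using assms that by (simp add: sum_fun_apply)
    qed
    ultimately show ?thesis by simp
  qed
  then show thesis using that[of "?d ` V"] assms by blast
qed

lemma card_le_eigenvalue_multiplicity:
  assumes "finite (verts g)" "B \<subseteq> eigenspace g t"
    "\<not> module.dependent (\<lambda>(c::real) (f::'a \<Rightarrow> real) x. c * f x) B"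
  shows "card B \<le> eigenvalue_multiplicity g t"
proof -
  interpret vs: vector_space "\<lambda>(c::real) (f::'a \<Rightarrow> real) x. c * f x" by (rule vector_space_fun)
  obtain T :: "('a \<Rightarrow> real) set" where T: "finite T" "{f. \<forall>x. x \<notin> verts g \<longrightarrow> f x = 0} \<subseteq> vs.span T"
    using finite_support_span[OF assms(1)] .
  obtain C where C: "B \<subseteq> C" "C \<subseteq> eigenspace g t" "vs.independent C" "eigenspace g t \<subseteq> vs.span C"
    using vs.maximal_independent_subset_extend[OF assms(2,3)] .
  have "C \<subseteq> vs.span T" using C(2) T(2) by (auto simp: eigenspace_def)
  then have "finite C" using vs.independent_span_bound[OF T(1) C(3)] by simp
  then have "card B \<le> card C" using C(1) by (rule card_mono)
  also have "card C = eigenvalue_multiplicity g t"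
    unfolding eigenvalue_multiplicity_def by (rule vs.basis_card_eq_dim[OF C(2,4,3)])
  finally show ?thesis .
qed

text \<open>Symmetry of the energy makes eigenfunctions of different eigenvalues orthogonal, hence
  independent in a space of finite dimension.\<close>

lemma finite_Spec_\<Gamma>: "finite (Spec (\<Gamma> n))"
proof -
  interpret vs: vector_space "\<lambda>(c::real) (f::addr \<Rightarrow> real) x. c * f x" by (rule vector_space_fun)
  let ?V = "verts (\<Gamma> n)"
  let ?dot = "\<lambda>f k. \<Sum>x\<in>?V. f x * k x :: real"
  have fin: "finite ?V" using wf_\<Gamma> by (simp add: wf_graph_def)
  define F where "F t = (SOME f. f \<in> eigenspace (\<Gamma> n) t \<and> f \<noteq> 0)" for t
  have F: "F t \<in> eigenspace (\<Gamma> n) t" "F t \<noteq> 0" if "t \<in> Spec (\<Gamma> n)" for t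
  proof -
    have "\<exists>f. f \<in> eigenspace (\<Gamma> n) t \<and> f \<noteq> 0" using that by (auto simp: Spec_def)
    from someI_ex[OF this] show "F t \<in> eigenspace (\<Gamma> n) t" "F t \<noteq> 0" by (auto simp: F_def)
  qed
  have nz: "?dot (F t) (F t) \<noteq> 0" if "t \<in> Spec (\<Gamma> n)" for t
  proof
    assume "?dot (F t) (F t) = 0"
    then have "\<forall>x\<in>?V. F t x = 0" using fin by (subst (asm) sum_nonneg_eq_0_iff) auto
    then have "F t = 0" using F(1)[OF that] by (force simp: eigenspace_def fun_eq_iff)
    then show False using F(2)[OF that] by simp
  qed
  have orth: "?dot (F s) (F t) = 0" if "s \<in> Spec (\<Gamma> n)" "t \<in> Spec (\<Gamma> n)" "s \<noteq> t" for s t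
  proof -
    have "energy (\<Gamma> n) (F s) (F t) = s * ?dot (F s) (F t)"
      "energy (\<Gamma> n) (F t) (F s) = t * ?dot (F t) (F s)"
      using F(1)[OF that(1)] F(1)[OF that(2)] by (simp_all add: eigenspace_\<Gamma>_iff)
    moreover have "?dot (F t) (F s) = ?dot (F s) (F t)" by (simp add: mult.commute)
    ultimately have "s * ?dot (F s) (F t) = t * ?dot (F s) (F t)"
      using energy_commute[of "\<Gamma> n" "F s" "F t"] by metis
    then show ?thesis using that by simp
  qed
  have inj: "inj_on F (Spec (\<Gamma> n))"
    using nz orth by (intro inj_onI) metis
  have "vs.independent (F ` Spec (\<Gamma> n))"
    unfolding vs.independent_explicit_finite_subsets
  proof (intro allI impI ballI)
    fix S u v assume S: "S \<subseteq> F ` Spec (\<Gamma> n)" "finite S" "(\<Sum>v\<in>S. (\<lambda>x. u v * v x)) = 0" "v \<in> S"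
    obtain t where t: "t \<in> Spec (\<Gamma> n)" "v = F t" using S by auto
    have "0 = ?dot (\<Sum>v\<in>S. (\<lambda>x. u v * v x)) v" by (simp add: S(3))
    also have "\<dots> = (\<Sum>w\<in>S. u w * ?dot w v)"
      by (simp add: sum_fun_apply sum_distrib_right sum_distrib_left mult.assoc, rule sum.swap)
    also have "\<dots> = (\<Sum>w\<in>S. if w = v then u v * ?dot v v else 0)"
    proof (rule sum.cong[OF refl])
      fix w assume "w \<in> S"
      then obtain s where "s \<in> Spec (\<Gamma> n)" "w = F s" using S by auto
      then show "u w * ?dot w v = (if w = v then u v * ?dot v v else 0)"
        using orth[of s t] t by auto
    qed
    also have "\<dots> = u v * ?dot v v" using S by simp
    finally show "u v = 0" using nz[OF t(1)] t(2) by simp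
  qed
  moreover obtain T :: "(addr \<Rightarrow> real) set" where T: "finite T" "{f. \<forall>x. x \<notin> ?V \<longrightarrow> f x = 0} \<subseteq> vs.span T"
    using finite_support_span[OF fin] .
  moreover have "F ` Spec (\<Gamma> n) \<subseteq> vs.span T"
    using T(2) F(1) by (auto simp: eigenspace_def)
  ultimately have "finite (F ` Spec (\<Gamma> n))" using vs.independent_span_bound by blast
  then show ?thesis using inj by (rule finite_imageD)
qed

text \<open>Extension by zero from the first copy gives eigenfunctions on \<open>\<Gamma> n\<close>;
  evaluation at the dual points shows independence.\<close>

lemma localized_family_multiplicity:
  assumes "localized_family n t c"
  shows "c \<le> eigenvalue_multiplicity (\<Gamma> n) t" and "c > 0 \<Longrightarrow> t \<in> Spec (\<Gamma> n)"
proof -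
  interpret vs: vector_space "\<lambda>(c::real) (f::addr \<Rightarrow> real) x. c * f x" by (rule vector_space_fun)
  obtain X where X: "X \<subseteq> inner_verts n" "card X = c"
    "\<forall>x\<in>X. \<exists>h. dirichlet h \<and> response n t h 0 0 \<and> h x = 1 \<and> (\<forall>y\<in>X - {x}. h y = 0)"
    using assms unfolding localized_family_def by blast
  obtain h where h: "\<And>x. x \<in> X \<Longrightarrow> dirichlet (h x) \<and> response n t (h x) 0 0 \<and> h x x = 1 \<and> (\<forall>y\<in>X - {x}. h x y = 0)"
    using bchoice[OF X(3)] by blast
  \<comment> \<open>\<open>h x\<close> is unrestricted off the vertices of \<open>G n\<close>,
    whereas \<open>eigenspace\<close> asks for zero outside \<open>verts (\<Gamma> n)\<close>; hence
    the truncation.\<close>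
  define F where "F x v = (if v \<in> verts (\<Gamma> n) then gjoin (h x) (\<lambda>_. 0) v else 0)" for x v
  have FX: "F x (Cp1 y) = of_bool (y = x)" if "x \<in> X" "y \<in> X" for x y
    using h[OF that(1)] that X(1) by (auto simp: F_def verts_\<Gamma>)
  have FE: "F x \<in> eigenspace (\<Gamma> n) t" if "x \<in> X" for x
  proof (rule eigenspace_\<Gamma>I)
    have hx: "h x Bd1 = 0" "h x Bd2 = 0" "response n t (h x) 0 0" using h[OF that] by (auto simp: dirichlet_def)
    show "response n t (gon1 (F x)) 0 0"
    proof (rule response_cong[OF hx(3)])
      fix y assume "y \<in> verts (G n)"
      then have "place Ctr Ctr Cp1 y \<in> verts (\<Gamma> n)"
        by (auto simp: verts_G verts_\<Gamma> place_inner_verts)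
      then show "h x y = gon1 (F x) y" using hx by (cases y) (simp_all add: F_def)
    qed
    show "response (n - 1) t (gon2 (F x)) 0 0"
    proof (rule response_cong[OF response_zero])
      show "0 = gon2 (F x) y" for y using hx by (cases y) (simp_all add: F_def)
    qed
    show "0 + 0 + 0 + 0 = t * F x Ctr" using hx by (simp add: F_def)
  qed (simp add: F_def)
  have inj: "inj_on F X"
  proof (rule inj_onI)
    fix x y assume "x \<in> X" "y \<in> X" "F x = F y"
    then show "x = y" using FX[of x x] FX[of y x] by auto
  qed
  have "vs.independent (F ` X)"
    unfolding vs.independent_explicit_finite_subsets
  proof (intro allI impI ballI)
    fix S u v assume S: "S \<subseteq> F ` X" "finite S" "(\<Sum>v\<in>S. (\<lambda>x. u v * v x)) = 0" "v \<in> S"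
    obtain x where x: "x \<in> X" "v = F x" using S by auto
    have "0 = (\<Sum>v\<in>S. (\<lambda>x. u v * v x)) (Cp1 x)" by (simp add: S(3))
    also have "\<dots> = (\<Sum>w\<in>S. u w * w (Cp1 x))" by (simp add: sum_fun_apply)
    also have "\<dots> = (\<Sum>w\<in>S. if w = v then u v else 0)"
    proof (rule sum.cong[OF refl])
      fix w assume "w \<in> S"
      then obtain y where "y \<in> X" "w = F y" using S by auto
      then show "u w * w (Cp1 x) = (if w = v then u v else 0)"
        using FX[of y x] x inj by (auto simp: inj_on_eq_iff)
    qed
    also have "\<dots> = u v" using S by simp
    finally show "u v = 0" by simp
  qed
  then have "card (F ` X) \<le> eigenvalue_multiplicity (\<Gamma> n) t"
    using FE wf_\<Gamma> by (intro card_le_eigenvalue_multiplicity) (auto simp: wf_graph_def)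
  then show "c \<le> eigenvalue_multiplicity (\<Gamma> n) t" using X(2) by (simp add: card_image inj)
  assume "c > 0"
  then obtain x where "x \<in> X" using X(2) by fastforce
  then have "F x (Cp1 x) \<noteq> 0" using FX[of x x] by simp
  then have "F x \<noteq> 0" by (auto simp: fun_eq_iff)
  then show "t \<in> Spec (\<Gamma> n)" using FE[OF \<open>x \<in> X\<close>] by (auto simp: Spec_def)
qed

text \<open>One inclusion holds even before taking closures: a Dirichlet eigenvalue with first zero
  \<open>k\<close> is an eigenvalue of \<open>\<Gamma> (k + 4)\<close>.\<close>

lemma closure_Spec_\<Gamma>: "closure (\<Union>n. Spec (\<Gamma> n)) = closure dirichlet_set"
proof
  have "(\<Union>n. Spec (\<Gamma> n)) \<subseteq> closure dirichlet_set"
  proof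
    fix t assume "t \<in> (\<Union>n. Spec (\<Gamma> n))"
    then obtain n where n: "t \<in> Spec (\<Gamma> n)" by blast
    show "t \<in> closure dirichlet_set"
      unfolding closure_approachable
    proof (intro allI impI)
      fix e :: real assume "e > 0"
      obtain s m where "s \<in> dirichlet_spec m" "\<bar>s - t\<bar> < e" using Spec_\<Gamma>_approx[OF n \<open>e > 0\<close>] .
      then show "\<exists>s\<in>dirichlet_set. dist s t < e" by (auto simp: dirichlet_set_def dist_real_def)
    qed
  qed
  then show "closure (\<Union>n. Spec (\<Gamma> n)) \<subseteq> closure dirichlet_set" by (simp add: closure_minimal)
  have "dirichlet_set \<subseteq> (\<Union>n. Spec (\<Gamma> n))"
  proof
    fix t assume "t \<in> dirichlet_set"
    then obtain n where "t \<in> dirichlet_spec n" by (auto simp: dirichlet_set_def)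
    then obtain k where "first_zero k t" using first_zeroE by blast
    then obtain c where c: "localized_family (k + 4 + 0) t c" "2 ^ 0 \<le> 2 * c"
      using first_zero.localized_family_growth by blast
    then show "t \<in> (\<Union>n. Spec (\<Gamma> n))" using localized_family_multiplicity(2)[OF c(1)] by auto
  qed
  then show "closure dirichlet_set \<subseteq> closure (\<Union>n. Spec (\<Gamma> n))" by (rule closure_mono)
qed

section \<open>The KNS measure\<close>

lemma emeasure_spectral_counting_measure:
  assumes "A \<in> sets borel"
  shows "emeasure (spectral_counting_measure n) A =
    (\<Sum>t\<in>A \<inter> Spec (\<Gamma> n). ennreal (real (eigenvalue_multiplicity (\<Gamma> n) t) / 2 ^ n))"
  unfolding spectral_counting_measure_def using assms
  by (subst emeasure_distr)
    (auto simp: measurable_point_measure_eq1 space_point_measure emeasure_point_measure_finite finite_Spec_\<Gamma>)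

lemma finite_borel_measure_spectral_counting_measure:
  "finite_borel_measure (spectral_counting_measure n)"
proof (intro finite_borel_measure.intro finite_borel_measure_axioms.intro finite_measureI)
  have "emeasure (spectral_counting_measure n) UNIV \<noteq> \<infinity>"
    by (subst emeasure_spectral_counting_measure) auto
  then show "emeasure (spectral_counting_measure n) (space (spectral_counting_measure n)) \<noteq> \<infinity>"
    by (simp add: spectral_counting_measure_def)
  show "sets (spectral_counting_measure n) = sets borel"
    by (simp add: spectral_counting_measure_def)
qed

text \<open>At least \<open>2 ^ j / 2\<close> of the \<open>2 ^ (k + 4 + j)\<close> eigenvalues
  equal \<open>t\<close>, a proportion independent of \<open>j\<close>.\<close>

lemma (in first_zero) spectral_counting_measure_ge:
  assumes "A \<in> sets borel" "t \<in> A"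
  shows "measure (spectral_counting_measure (k + 4 + j)) A \<ge> 1 / 2 ^ (k + 5)"
proof -
  let ?n = "k + 4 + j"
  interpret finite_borel_measure "spectral_counting_measure ?n"
    by (rule finite_borel_measure_spectral_counting_measure)
  obtain c where c: "localized_family ?n t c" "2 ^ j \<le> 2 * c" using localized_family_growth by blast
  have "c > 0" using c(2) by (cases c) auto
  then have t: "t \<in> Spec (\<Gamma> ?n)" and mult: "c \<le> eigenvalue_multiplicity (\<Gamma> ?n) t"
    using localized_family_multiplicity[OF c(1)] by auto
  have "real (2 ^ j) \<le> real (2 * c)" using c(2) by (simp only: of_nat_le_iff)
  then have "(1::real) / 2 ^ (k + 5) \<le> real c / 2 ^ ?n"
    by (simp add: field_simps power_add)
  also have "\<dots> \<le> real (eigenvalue_multiplicity (\<Gamma> ?n) t) / 2 ^ ?n"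
    using mult by (simp add: divide_right_mono)
  finally have "ennreal (1 / 2 ^ (k + 5)) \<le> ennreal (real (eigenvalue_multiplicity (\<Gamma> ?n) t) / 2 ^ ?n)"
    by (rule ennreal_leI)
  also have "\<dots> \<le> emeasure (spectral_counting_measure ?n) A"
    unfolding emeasure_spectral_counting_measure[OF assms(1)]
    using t assms(2) finite_Spec_\<Gamma> by (intro member_le_sum) auto
  finally show ?thesis
    by (simp add: emeasure_eq_measure del: ennreal_le_iff) (subst (asm) ennreal_le_iff, auto)
qed

text \<open>Only countably many points are atoms. Weak convergence controls \<open>cdf\<close> at
  the other points, so intervals are cut there.\<close>

lemma (in real_distribution) continuity_point:
  assumes "a < b"
  obtains x where "a < x" "x < b" "isCont (cdf M) x"
proof -
  have "\<not> {a<..<b} \<subseteq> {x. measure M {x} > 0}"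
    using countable_atoms countable_subset uncountable_open_interval assms by blast
  then obtain x where "x \<in> {a<..<b}" "\<not> measure M {x} > 0" by blast
  then show thesis using that[of x] measure_nonneg[of M "{x}"] by (auto simp: isCont_cdf less_eq_real_def)
qed

lemma KNS_measure_interval:
  assumes "is_KNS_measure \<mu>" "isCont (cdf \<mu>) a" "isCont (cdf \<mu>) b" "a < b"
  shows "(\<lambda>n. measure (spectral_counting_measure n) {a<..b}) \<longlonglongrightarrow> measure \<mu> {a<..b}"
proof -
  interpret real_distribution \<mu> using assms(1) by (simp add: is_KNS_measure_def)
  have "(\<lambda>n. cdf (spectral_counting_measure n) b - cdf (spectral_counting_measure n) a)
      \<longlonglongrightarrow> cdf \<mu> b - cdf \<mu> a"
    using assms by (intro tendsto_diff) (auto simp: is_KNS_measure_def weak_conv_m_def weak_conv_def)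
  then show ?thesis
    using finite_borel_measure.cdf_diff_eq[OF finite_borel_measure_spectral_counting_measure \<open>a < b\<close>]
      cdf_diff_eq[OF \<open>a < b\<close>] by simp
qed

text \<open>Around a point off the closure the counting measures of a small interval vanish for
  every \<open>n\<close>; around a Dirichlet eigenvalue they have a positive lower bound independent
  of large \<open>n\<close>. Both facts survive the limit.\<close>

lemma KNS_measure_support:
  assumes "is_KNS_measure \<mu>"
  shows "measure_support \<mu> = closure (\<Union>n. Spec (\<Gamma> n))" (is "_ = ?K")
proof
  interpret real_distribution \<mu> using assms by (simp add: is_KNS_measure_def)
  show "measure_support \<mu> \<subseteq> ?K"
  proof
    fix x assume x: "x \<in> measure_support \<mu>"
    show "x \<in> ?K"
    proof (rule ccontr)
      assume "x \<notin> ?K"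
      then obtain e where e: "e > 0" "ball x e \<subseteq> - ?K"
        using open_contains_ball[of "- ?K"] by (auto simp: closed_closure open_Compl)
      obtain a where a: "x - e < a" "a < x" "isCont (cdf \<mu>) a" using continuity_point[of "x - e" x] e by auto
      obtain b where b: "x < b" "b < x + e" "isCont (cdf \<mu>) b" using continuity_point[of x "x + e"] e by auto
      have "{a<..b} \<subseteq> ball x e" using a b by (auto simp: dist_real_def)
      then have "{a<..b} \<inter> Spec (\<Gamma> n) = {}" for n
        using e(2) closure_subset[of "\<Union>n. Spec (\<Gamma> n)"] by blast
      then have "measure (spectral_counting_measure n) {a<..b} = 0" for n
        by (simp add: Sigma_Algebra.measure_def emeasure_spectral_counting_measure)
      then have "measure \<mu> {a<..b} = 0"
        using KNS_measure_interval[OF assms a(3) b(3)] a b LIMSEQ_unique[OF _ tendsto_const] by simp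
      moreover have "measure \<mu> {a<..<b} \<le> measure \<mu> {a<..b}" by (intro finite_measure_mono) auto
      ultimately have "emeasure \<mu> {a<..<b} = 0"
        using measure_nonneg[of \<mu> "{a<..<b}"] by (simp add: emeasure_eq_measure)
      moreover have "emeasure \<mu> {a<..<b} > 0" using x a b by (auto simp: measure_support_def)
      ultimately show False by simp
    qed
  qed
  show "?K \<subseteq> measure_support \<mu>"
    unfolding measure_support_def
  proof clarify
    fix x and U :: "real set" assume x: "x \<in> ?K" and U: "open U" "x \<in> U"
    obtain t where t: "t \<in> dirichlet_set" "t \<in> U"
      using x U open_Int_closure_eq_empty[OF U(1), of dirichlet_set] unfolding closure_Spec_\<Gamma> by auto
    then obtain e where e: "e > 0" "ball t e \<subseteq> U" using U(1) open_contains_ball by blast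
    obtain n where "t \<in> dirichlet_spec n" using t by (auto simp: dirichlet_set_def)
    then obtain k where "first_zero k t" using first_zeroE by blast
    then interpret first_zero k t .
    obtain a where a: "t - e < a" "a < t" "isCont (cdf \<mu>) a" using continuity_point[of "t - e" t] e by auto
    obtain b where b: "t < b" "b < t + e" "isCont (cdf \<mu>) b" using continuity_point[of t "t + e"] e by auto
    have "(\<lambda>n. measure (spectral_counting_measure n) {a<..b}) \<longlonglongrightarrow> measure \<mu> {a<..b}"
      using KNS_measure_interval[OF assms a(3) b(3)] a b by simp
    moreover have "\<forall>\<^sub>F n in sequentially. 1 / 2 ^ (k + 5) \<le> measure (spectral_counting_measure n) {a<..b}"
      unfolding eventually_sequentially
    proof (intro exI[of _ "k + 4"] allI impI)
      fix n assume "n \<ge> k + 4"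
      then obtain j where "n = k + 4 + j" by (auto simp: le_iff_add)
      then show "1 / 2 ^ (k + 5) \<le> measure (spectral_counting_measure n) {a<..b}"
        using spectral_counting_measure_ge[of "{a<..b}" j] a b by simp
    qed
    ultimately have "1 / 2 ^ (k + 5) \<le> measure \<mu> {a<..b}"
      by (intro tendsto_lowerbound) auto
    moreover have "(0::real) < 1 / 2 ^ (k + 5)" by simp
    ultimately have "0 < measure \<mu> {a<..b}" by linarith
    also have "measure \<mu> {a<..b} \<le> measure \<mu> U"
    proof (rule finite_measure_mono)
      show "{a<..b} \<subseteq> U" using a b e(2) by (auto simp: dist_real_def subset_eq)
      show "U \<in> sets \<mu>" using U by simp
    qed
    finally show "0 < emeasure \<mu> U" by (simp add: emeasure_eq_measure)
  qed
qed

theorem theorem5p12: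
  shows "(\<forall>\<mu>. is_KNS_measure \<mu> \<longrightarrow> closure (\<Union>n. Spec (\<Gamma> n)) = measure_support \<mu>) \<and>
    Cantor_set (closure (\<Union>n. Spec (\<Gamma> n)))"
  using KNS_measure_support Cantor_closure_dirichlet_set by (simp add: closure_Spec_\<Gamma>)

end
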